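(* Let $\beta=(\beta_1,\ldots,\beta_{2\ell+1})$ be a composition with an odd number of parts and let $k\ge0$ be any integer. Then the map $\Phi$ defined by steps (PH1)–(PH3) below is a bijection from the set $\mathcal{I}^r_k(\beta)$ of restricted lower order ideals of the fence $F(\beta)$ with $k$ elements to the set $\mathcal{U}^r_k(\beta)$ of restricted filters of $F(\beta)$ with $k$ elements.
   Context: The fence $F(\beta)$ is obtained from chains $S_1,\dots,S_{2\ell+1}$ with $\#S_i=\beta_i+1$ by identifying the maximal elements of $S_i,S_{i+1}$ for $i$ odd and the minimal elements for $i$ even. Ascending segments: $A_j=S_{2j-1}$ ($1\le j\le\ell+1$); descending segments: $D_i=S_{2i}$ ($1\le i\le\ell$). An element is shared if it lies on two segments. Let $\tilde A_j$ be the unshared elements of $A_j$, $\alpha_j=1+\#\tilde A_j$ (so $\alpha_1=\beta_1+1$, $\alpha_{\ell+1}=\beta_{2\ell+1}+1$, $\alpha_j=\beta_{2j-1}$ otherwise), $\delta_i=\beta_{2i}$, so $\#D_i=\delta_i+1$. A lower order ideal $I$ is encoded by $a_j=\#(I\cap\tilde A_j)$, $d_i=\#(I\cap D_i)$; a filter $U$ by $b_j=\#(U\cap\tilde A_j)$, $e_i=\#(U\cap D_i)$. The ideal $I$ is restricted if $d_1\le\delta_1$, and either $d_\ell\neq1$ or $a_{\ell+1}<\alpha_{\ell+1}-1$. The filter $U$ is restricted if $e_\ell\le\delta_\ell$, and either $e_1\neq1$ or $b_1<\alpha_1-1$. (For $\ell=0$ these conditions are vacuous.) Map $\phi$ on finite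 sequences of nonnegative integers: a block is a maximal run of consecutive positive entries; its trailing ones $T$ is its maximal (possibly empty) final segment of ones; $B'$ is the block with $T$ removed; (P1) for each block with nonempty $T$, exchange $T$ with the $0$ immediately following it; (P2) for each block with $\#B'\ge2$, decrease the last entry of $B'$ by $1$ and increase its first entry by $1$. $\Phi$: given $I$ encoded by $(a,d)$: (PH1) for every $i\in[\ell]$ with $d_i=1$ and $a_{i+1}<\alpha_{i+1}-1$, set $d_i:=0$, $a_{i+1}:=a_{i+1}+1$. (PH2) Split $d_1,\ldots,d_\ell$ into factors by cutting between $d_{i-1}$ and $d_i$ for each $i\in[2,\ell]$ with $a_i<\alpha_i-1$; apply $\phi$ to each factor and concatenate to get $e$; set $b:=a$. (PH3) For every $i\in[\ell]$ with $e_i=0$ and $b_i>0$, set $e_i:=1$, $b_i:=b_i-1$. $\Phi(I)$ is the filter encoded by $(b,e)$. *)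

theory Defs
  imports Main
begin

text \<open>
  The fence of a composition \<open>\<beta>\<close> is modelled on \<open>{0..sum_list \<beta>}\<close>, numbering the elements
  consecutively along the fence from left to right. With all lists of parameters written with
  indices from 1, the segment \<open>S\<^sub>i\<close> is the interval between the partial sums
  \<open>\<beta>\<^sub>1 + \<dots> + \<beta>\<^bsub>i-1\<^esub>\<close> and \<open>\<beta>\<^sub>1 + \<dots> + \<beta>\<^sub>i\<close>, so consecutive segments overlap in exactly one point,
  which is the element obtained by identification. Segments with odd index ascend with the
  numbering, segments with even index descend.
\<close>

definition junction :: "nat list \<Rightarrow> nat \<Rightarrow> nat" where
  "junction \<beta> i = sum_list (take i \<beta>)"

definition segment :: "nat list \<Rightarrow> nat \<Rightarrow> nat set" where
  "segment \<beta> i = {junction \<beta> (i - 1)..junction \<beta> i}"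

definition fence :: "nat list \<Rightarrow> nat set" where
  "fence \<beta> = (\<Union>i\<in>{1..length \<beta>}. segment \<beta> i)"

definition fence_le :: "nat list \<Rightarrow> nat \<Rightarrow> nat \<Rightarrow> bool" where
  "fence_le \<beta> x y \<longleftrightarrow> (\<exists>i\<in>{1..length \<beta>}. x \<in> segment \<beta> i \<and> y \<in> segment \<beta> i \<and>
     (if odd i then x \<le> y else y \<le> x))"

definition fence_ideals :: "nat list \<Rightarrow> nat set set" where
  "fence_ideals \<beta> = {I. I \<subseteq> fence \<beta> \<and> (\<forall>y\<in>I. \<forall>x\<in>fence \<beta>. fence_le \<beta> x y \<longrightarrow> x \<in> I)}"

definition fence_filters :: "nat list \<Rightarrow> nat set set" where
  "fence_filters \<beta> = {U. U \<subseteq> fence \<beta> \<and> (\<forall>x\<in>U. \<forall>y\<in>fence \<beta>. fence_le \<beta> x y \<longrightarrow> y \<in> U)}"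

text \<open>The number \<open>\<ell>\<close>, where \<open>\<beta>\<close> has \<open>2\<ell> + 1\<close> parts.\<close>

definition ell :: "nat list \<Rightarrow> nat" where
  "ell \<beta> = length \<beta> div 2"

definition asc :: "nat list \<Rightarrow> nat \<Rightarrow> nat set" where
  "asc \<beta> j = segment \<beta> (2 * j - 1)"

definition desc :: "nat list \<Rightarrow> nat \<Rightarrow> nat set" where
  "desc \<beta> i = segment \<beta> (2 * i)"

definition shared :: "nat list \<Rightarrow> nat \<Rightarrow> bool" where
  "shared \<beta> x \<longleftrightarrow> (\<exists>i\<in>{1..length \<beta>}. \<exists>i'\<in>{1..length \<beta>}.
     i \<noteq> i' \<and> x \<in> segment \<beta> i \<and> x \<in> segment \<beta> i')"

definition asc_unshared :: "nat list \<Rightarrow> nat \<Rightarrow> nat set" where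
  "asc_unshared \<beta> j = {x \<in> asc \<beta> j. \<not> shared \<beta> x}"

definition alpha :: "nat list \<Rightarrow> nat \<Rightarrow> nat" where
  "alpha \<beta> j = 1 + card (asc_unshared \<beta> j)"

definition delta :: "nat list \<Rightarrow> nat \<Rightarrow> nat" where
  "delta \<beta> i = \<beta> ! (2 * i - 1)"

text \<open>
  The encoding of a set \<open>X\<close> (an ideal or a filter): \<open>acode \<beta> X j\<close> is \<open>a\<^sub>j\<close> (or \<open>b\<^sub>j\<close>) for
  \<open>1 \<le> j \<le> \<ell> + 1\<close>, and \<open>dcode \<beta> X i\<close> is \<open>d\<^sub>i\<close> (or \<open>e\<^sub>i\<close>) for \<open>1 \<le> i \<le> \<ell>\<close>.
\<close>

definition acode :: "nat list \<Rightarrow> nat set \<Rightarrow> nat \<Rightarrow> nat" where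
  "acode \<beta> X j = card (X \<inter> asc_unshared \<beta> j)"

definition dcode :: "nat list \<Rightarrow> nat set \<Rightarrow> nat \<Rightarrow> nat" where
  "dcode \<beta> X i = card (X \<inter> desc \<beta> i)"

definition restricted_ideal :: "nat list \<Rightarrow> nat set \<Rightarrow> bool" where
  "restricted_ideal \<beta> I \<longleftrightarrow> I \<in> fence_ideals \<beta> \<and>
     (ell \<beta> \<ge> 1 \<longrightarrow>
        dcode \<beta> I 1 \<le> delta \<beta> 1 \<and>
        (dcode \<beta> I (ell \<beta>) \<noteq> 1 \<or> acode \<beta> I (ell \<beta> + 1) < alpha \<beta> (ell \<beta> + 1) - 1))"

definition restricted_filter :: "nat list \<Rightarrow> nat set \<Rightarrow> bool" where
  "restricted_filter \<beta> U \<longleftrightarrow> U \<in> fence_filters \<beta> \<and>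
     (ell \<beta> \<ge> 1 \<longrightarrow>
        dcode \<beta> U (ell \<beta>) \<le> delta \<beta> (ell \<beta>) \<and>
        (dcode \<beta> U 1 \<noteq> 1 \<or> acode \<beta> U 1 < alpha \<beta> 1 - 1))"

definition restricted_ideals :: "nat list \<Rightarrow> nat \<Rightarrow> nat set set" where
  "restricted_ideals \<beta> k = {I. restricted_ideal \<beta> I \<and> card I = k}"

definition restricted_filters :: "nat list \<Rightarrow> nat \<Rightarrow> nat set set" where
  "restricted_filters \<beta> k = {U. restricted_filter \<beta> U \<and> card U = k}"

text \<open>The trailing ones \<open>T\<close> of a block \<open>B\<close>, and the block \<open>B'\<close> with \<open>T\<close> removed.\<close>

definition trailing_ones :: "nat list \<Rightarrow> nat list" where
  "trailing_ones B = rev (takeWhile (\<lambda>x. x = 1) (rev B))"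

definition drop_trailing_ones :: "nat list \<Rightarrow> nat list" where
  "drop_trailing_ones B = rev (dropWhile (\<lambda>x. x = 1) (rev B))"

definition shift_unit :: "nat list \<Rightarrow> nat list" where
  "shift_unit B =
     (if length B \<ge> 2 then (hd B + 1) # butlast (tl B) @ [last B - 1] else B)"

text \<open>
  The map \<open>\<phi>\<close> processes the blocks of the given sequence from left to right. A block followed by
  a \<open>0\<close> is rewritten from \<open>B' T 0\<close> to \<open>B' 0 T\<close>, moving one unit from the end of \<open>B'\<close> to
  its start; if \<open>T\<close> is empty the exchange is the identity. A block at the very end of the sequence has no \<open>0\<close> to exchange with,
  so its trailing ones stay in place; this is a convention only, since \<open>\<phi>\<close> is applied below to factors that
  do not end in a \<open>1\<close>.
\<close>

function phi :: "nat list \<Rightarrow> nat list" where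
  "phi [] = []"
| "phi (0 # xs) = 0 # phi xs"
| "phi (Suc x # xs) =
     (let B = takeWhile (\<lambda>y. y > 0) (Suc x # xs);
          R = dropWhile (\<lambda>y. y > 0) (Suc x # xs);
          T = trailing_ones B;
          B' = drop_trailing_ones B
      in if R = [] then shift_unit B' @ T
         else shift_unit B' @ [0] @ T @ phi (tl R))"
  by pat_completeness auto
termination
proof (relation "measure length", goal_cases)
  case (3 x xs)
  then show ?case
    using length_dropWhile_le[of "\<lambda>y. y > 0" xs] by (simp add: le_imp_less_Suc)
qed auto

text \<open>
  \<open>factors c i xs\<close> splits \<open>xs\<close>, whose entries are numbered \<open>i, i + 1, \<dots>\<close>, by cutting just
  before every entry (other than the first one) whose number satisfies \<open>c\<close>.
\<close>

fun factors :: "(nat \<Rightarrow> bool) \<Rightarrow> nat \<Rightarrow> 'a list \<Rightarrow> 'a list list" where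
  "factors c i [] = []"
| "factors c i [x] = [[x]]"
| "factors c i (x # y # ys) =
     (let fs = factors c (i + 1) (y # ys)
      in if c (i + 1) then [x] # fs else (x # hd fs) # tl fs)"

text \<open>
  All conditions within one step refer to the values before the
  step; different \<open>i\<close> touch different entries.
\<close>

definition PH1 :: "nat list \<Rightarrow> (nat \<Rightarrow> nat) \<times> (nat \<Rightarrow> nat) \<Rightarrow> (nat \<Rightarrow> nat) \<times> (nat \<Rightarrow> nat)" where
  "PH1 \<beta> = (\<lambda>(a, d).
     let act = (\<lambda>i. i \<in> {1..ell \<beta>} \<and> d i = 1 \<and> a (i + 1) < alpha \<beta> (i + 1) - 1)
     in (\<lambda>j. if act (j - 1) then a j + 1 else a j,
         \<lambda>i. if act i then 0 else d i))"

definition PH2 :: "nat list \<Rightarrow> (nat \<Rightarrow> nat) \<times> (nat \<Rightarrow> nat) \<Rightarrow> (nat \<Rightarrow> nat) \<times> (nat \<Rightarrow> nat)" where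
  "PH2 \<beta> = (\<lambda>(a, d).
     let ds = map d [1..<ell \<beta> + 1];
         es = concat (map phi (factors (\<lambda>i. a i < alpha \<beta> i - 1) 1 ds))
     in (a, \<lambda>i. es ! (i - 1)))"

definition PH3 :: "nat list \<Rightarrow> (nat \<Rightarrow> nat) \<times> (nat \<Rightarrow> nat) \<Rightarrow> (nat \<Rightarrow> nat) \<times> (nat \<Rightarrow> nat)" where
  "PH3 \<beta> = (\<lambda>(b, e).
     let act = (\<lambda>i. i \<in> {1..ell \<beta>} \<and> e i = 0 \<and> b i > 0)
     in (\<lambda>j. if act j then b j - 1 else b j,
         \<lambda>i. if act i then 1 else e i))"

definition encodes :: "nat list \<Rightarrow> nat set \<Rightarrow> (nat \<Rightarrow> nat) \<times> (nat \<Rightarrow> nat) \<Rightarrow> bool" where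
  "encodes \<beta> X = (\<lambda>(b, e).
     (\<forall>j\<in>{1..ell \<beta> + 1}. acode \<beta> X j = b j) \<and> (\<forall>i\<in>{1..ell \<beta>}. dcode \<beta> X i = e i))"

definition Phi :: "nat list \<Rightarrow> nat set \<Rightarrow> nat set" where
  "Phi \<beta> I = (THE U. U \<in> fence_filters \<beta> \<and>
     encodes \<beta> U (PH3 \<beta> (PH2 \<beta> (PH1 \<beta> (acode \<beta> I, dcode \<beta> I)))))"

text \<open>
  The model agrees with the gluing construction: the segments are chains of the right sizes,
  consecutive ones meet in a common maximum or minimum, and other pairs of segments are disjoint.
\<close>

lemma junction_mono: "i \<le> j \<Longrightarrow> junction \<beta> i \<le> junction \<beta> j"
  unfolding junction_def
  by (metis le_add1 min.absorb2 sum_list.append take_add take_take le_Suc_ex)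

lemma junction_Suc: "i < length \<beta> \<Longrightarrow> junction \<beta> (Suc i) = junction \<beta> i + \<beta> ! i"
  by (simp add: junction_def take_Suc_conv_app_nth)

lemma junction_strict_mono:
  assumes "\<forall>x\<in>set \<beta>. 0 < x" "i < j" "j \<le> length \<beta>"
  shows "junction \<beta> i < junction \<beta> j"
proof -
  have "junction \<beta> i < junction \<beta> (Suc i)"
    using assms by (simp add: junction_Suc)
  also have "\<dots> \<le> junction \<beta> j"
    using assms by (intro junction_mono) simp
  finally show ?thesis .
qed

lemma card_segment: "i \<in> {1..length \<beta>} \<Longrightarrow> card (segment \<beta> i) = \<beta> ! (i - 1) + 1"
  using junction_Suc[of "i - 1" \<beta>] by (auto simp: segment_def)

lemma segment_Int_Suc:
  assumes "i \<ge> 1"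
  shows "segment \<beta> i \<inter> segment \<beta> (Suc i) = {junction \<beta> i}"
  using junction_mono[of "i - 1" i \<beta>] junction_mono[of i "Suc i" \<beta>]
  by (auto simp: segment_def)

lemma segment_disjoint:
  assumes "\<forall>x\<in>set \<beta>. 0 < x" "1 \<le> i" "Suc i < j" "j \<le> length \<beta>"
  shows "segment \<beta> i \<inter> segment \<beta> j = {}"
proof -
  have "junction \<beta> i < junction \<beta> (j - 1)"
    using assms by (intro junction_strict_mono) auto
  then show ?thesis by (auto simp: segment_def)
qed

lemma fence_eq:
  assumes "\<beta> \<noteq> []"
  shows "fence \<beta> = {0..sum_list \<beta>}"
proof -
  have "(\<Union>i\<in>{1..n}. segment \<beta> i) = {0..junction \<beta> n}" if "n \<ge> 1" for n
    using that
  proof (induction n rule: dec_induct)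
    case base
    then show ?case by (simp add: segment_def junction_def)
  next
    case (step n)
    have "{1..Suc n} = insert (Suc n) {1..n}" by auto
    then have "(\<Union>i\<in>{1..Suc n}. segment \<beta> i) = {junction \<beta> n..junction \<beta> (Suc n)} \<union> {0..junction \<beta> n}"
      using step.IH by (simp add: segment_def)
    then show ?case using junction_mono[of n "Suc n" \<beta>] by auto
  qed
  from this[of "length \<beta>"] assms show ?thesis
    by (simp add: fence_def junction_def Suc_le_eq)
qed

lemma fence_le_antisym:
  assumes "\<forall>x\<in>set \<beta>. 0 < x" "fence_le \<beta> x y" "fence_le \<beta> y x"
  shows "x = y"
proof -
  have *: "x = y" if "1 \<le> i" "i < j" "j \<le> length \<beta>"
    "x \<in> segment \<beta> i" "y \<in> segment \<beta> i" "x \<in> segment \<beta> j" "y \<in> segment \<beta> j" for i j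
  proof (cases "j = Suc i")
    case True
    then have "x \<in> {junction \<beta> i}" "y \<in> {junction \<beta> i}"
      using segment_Int_Suc[OF that(1), of \<beta>] that by blast+
    then show ?thesis by simp
  next
    case False
    then show ?thesis using segment_disjoint[OF assms(1) that(1) _ that(3)] that by fastforce
  qed
  from assms(2,3) obtain i j where
    "1 \<le> i" "i \<le> length \<beta>" "1 \<le> j" "j \<le> length \<beta>"
    "x \<in> segment \<beta> i" "y \<in> segment \<beta> i" "x \<in> segment \<beta> j" "y \<in> segment \<beta> j"
    "if odd i then x \<le> y else y \<le> x" "if odd j then y \<le> x else x \<le> y"
    by (auto simp: fence_le_def)
  then show ?thesis
    using *[of i j] *[of j i] by (cases i j rule: linorder_cases) (auto split: if_splits)
qed

lemma fence_le_trans: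
  assumes "\<forall>x\<in>set \<beta>. 0 < x" "fence_le \<beta> x y" "fence_le \<beta> y z"
  shows "fence_le \<beta> x z"
proof -
  from assms(2,3) obtain i j where ij:
    "1 \<le> i" "i \<le> length \<beta>" "1 \<le> j" "j \<le> length \<beta>"
    "x \<in> segment \<beta> i" "y \<in> segment \<beta> i" "y \<in> segment \<beta> j" "z \<in> segment \<beta> j"
    "if odd i then x \<le> y else y \<le> x" "if odd j then y \<le> z else z \<le> y"
    by (auto simp: fence_le_def)
  consider "i = j" | "j = Suc i" | "i = Suc j" | "Suc i < j" | "Suc j < i" by linarith
  then show ?thesis
  proof cases
    case 1
    then show ?thesis using ij unfolding fence_le_def
      by (intro bexI[of _ i]) (auto split: if_splits)
  next
    case 2
    then have "y = junction \<beta> i" using segment_Int_Suc[of i \<beta>] ij by blast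
    then have "x = y \<or> y = z" using ij 2 by (auto simp: segment_def split: if_splits)
    then show ?thesis using assms by auto
  next
    case 3
    then have "y = junction \<beta> j" using segment_Int_Suc[of j \<beta>] ij by blast
    then have "x = y \<or> y = z" using ij 3 by (auto simp: segment_def split: if_splits)
    then show ?thesis using assms by auto
  next
    case 4
    then show ?thesis using segment_disjoint[OF assms(1), of i j] ij by auto
  next
    case 5
    then show ?thesis using segment_disjoint[OF assms(1), of j i] ij by auto
  qed
qed

lemma partial_order_on_fence:
  assumes "\<forall>x\<in>set \<beta>. 0 < x"
  shows "partial_order_on (fence \<beta>) {(x, y). fence_le \<beta> x y}"
  unfolding partial_order_on_def preorder_on_def
proof (intro conjI)
  show "refl_on (fence \<beta>) {(x, y). fence_le \<beta> x y}"
    by (auto simp: refl_on_def fence_def fence_le_def)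
  show "trans {(x, y). fence_le \<beta> x y}"
    using fence_le_trans[OF assms] by (auto intro!: transI)
  show "antisym {(x, y). fence_le \<beta> x y}"
    using fence_le_antisym[OF assms] by (auto intro!: antisymI)
  show "{(x, y). fence_le \<beta> x y} \<subseteq> fence \<beta> \<times> fence \<beta>"
    by (auto simp: fence_def fence_le_def)
qed

lemma segment_Int_Suc_extremal:
  assumes "x \<in> segment \<beta> i \<union> segment \<beta> (Suc i)" "1 \<le> i" "Suc i \<le> length \<beta>"
  shows "if odd i then fence_le \<beta> x (junction \<beta> i) else fence_le \<beta> (junction \<beta> i) x"
proof -
  have J: "junction \<beta> i \<in> segment \<beta> i" "junction \<beta> i \<in> segment \<beta> (Suc i)"
    using segment_Int_Suc[OF assms(2), of \<beta>] by auto
  from assms(1) show ?thesis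
  proof
    assume "x \<in> segment \<beta> i"
    then show ?thesis using assms J unfolding fence_le_def
      by (auto intro!: bexI[of _ i]) (auto simp: segment_def)
  next
    assume "x \<in> segment \<beta> (Suc i)"
    then show ?thesis using assms J unfolding fence_le_def
      by (auto intro!: bexI[of _ "Suc i"]) (auto simp: segment_def)
  qed
qed

end

theory Submission
  imports Defs
begin

text \<open>
  The map \<open>\<phi>\<close> is local. Call a position a run position if the sequence reads \<open>1, \<dots>, 1, 0\<close> from
  it on. At a run position, \<open>\<phi>\<close> writes \<open>1\<close> or \<open>0\<close> according to whether the preceding entry is \<open>1\<close>;
  at any other position it adds \<open>1\<close> if the preceding position is a run position or a cut precedes,
  and subtracts \<open>1\<close> if the following position is a run position or a cut follows. The run positions
  are also those up to which the image reads \<open>0, 1, \<dots>, 1\<close>, and with this the relation between a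
  sequence and its image becomes symmetric under exchanging the two and reading them backwards. The
  same reversal turns \<open>PH3\<close> into the inverse of \<open>PH1\<close> and restricted filters of \<open>\<beta>\<close> into
  restricted ideals of \<open>rev \<beta>\<close>. Hence \<open>\<Phi>\<close> for \<open>rev \<beta>\<close>, read backwards, is the inverse of \<open>\<Phi>\<close>
  for \<open>\<beta>\<close>.
\<close>

section \<open>A local description of the map on sequences\<close>

text \<open>
  The end of a sequence counts as \<open>0\<close>; this is harmless because \<open>\<phi>\<close> is only applied to sequences
  not ending in \<open>1\<close>.
\<close>

fun ones_then_zero :: "nat list \<Rightarrow> bool" where
  "ones_then_zero [] = True"
| "ones_then_zero (x # xs) = (x = 0 \<or> x = 1 \<and> ones_then_zero xs)"

text \<open>
  The flag \<open>p\<close> says that the entry before the list is \<open>1\<close>, the flag \<open>f\<close> that the list starts a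
  new block.
\<close>

fun phi_from :: "bool \<Rightarrow> bool \<Rightarrow> nat list \<Rightarrow> nat list" where
  "phi_from p f [] = []"
| "phi_from p f (x # xs) =
     (if ones_then_zero (x # xs) then of_bool p else x + of_bool f - of_bool (ones_then_zero xs))
     # phi_from (x = 1) (ones_then_zero (x # xs)) xs"

definition trimmed_block :: "nat list \<Rightarrow> bool" where
  "trimmed_block B \<longleftrightarrow> (\<forall>x\<in>set B. 0 < x) \<and> (B = [] \<or> last B \<noteq> 1)"

lemma trimmed_block_Cons:
  "trimmed_block (x # B) \<longleftrightarrow> 0 < x \<and> trimmed_block B \<and> (B = [] \<longrightarrow> x \<noteq> 1)"
  by (auto simp: trimmed_block_def)

lemma ones_then_zero_replicate: "ones_then_zero (replicate m 1 @ 0 # xs)"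
  by (induction m) auto

lemma not_ones_then_zero_trimmed_block:
  "trimmed_block B \<Longrightarrow> B \<noteq> [] \<Longrightarrow> \<not> ones_then_zero (B @ xs)"
  by (induction B) (auto simp: trimmed_block_Cons)

lemma split_trailing_ones:
  obtains B m where "A = B @ replicate m 1" "B = [] \<or> last B \<noteq> (1 :: nat)"
proof (induction A arbitrary: thesis rule: rev_induct)
  case Nil
  then show ?case by (metis append_Nil replicate_0)
next
  case (snoc x A)
  show ?case
  proof (cases "x = 1")
    case True
    obtain B m where "A = B @ replicate m 1" "B = [] \<or> last B \<noteq> 1"
      using snoc.IH by blast
    then show ?thesis
      using True by (intro snoc.prems[of B "Suc m"]) (simp_all add: replicate_append_same)
  next
    case False
    then show ?thesis by (intro snoc.prems[of "A @ [x]" 0]) simp_all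
  qed
qed

lemma sequence_block_induct [consumes 1, case_names block zero]:
  assumes "xs = [] \<or> last xs \<noteq> (1 :: nat)"
    and block: "\<And>B. trimmed_block B \<Longrightarrow> P B"
    and zero: "\<And>B m ys. trimmed_block B \<Longrightarrow> P ys \<Longrightarrow> P (B @ replicate m 1 @ 0 # ys)"
  shows "P xs"
  using assms(1)
proof (induction xs rule: measure_induct_rule[of length])
  case (less xs)
  obtain A R where xs_eq: "xs = A @ R" and pos: "\<forall>x\<in>set A. 0 < x" and hd_R: "R = [] \<or> hd R = 0"
  proof
    show "xs = takeWhile ((<) 0) xs @ dropWhile ((<) 0) xs" by simp
    show "\<forall>x\<in>set (takeWhile ((<) 0) xs). 0 < x" by (auto dest: set_takeWhileD)
    show "dropWhile ((<) 0) xs = [] \<or> hd (dropWhile ((<) 0) xs) = 0"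
      by (metis hd_dropWhile not_gr_zero)
  qed
  obtain B m where A_eq: "A = B @ replicate m 1" and last_B: "B = [] \<or> last B \<noteq> 1"
    by (rule split_trailing_ones[of A])
  have trimmed: "trimmed_block B"
    using pos last_B unfolding A_eq trimmed_block_def set_append by blast
  show ?case
  proof (cases R)
    case Nil
    then have "xs = B @ replicate m 1" using xs_eq A_eq by simp
    moreover from this have "m = 0" using less.prems by (cases "m = 0") auto
    ultimately show ?thesis using block[OF trimmed] by simp
  next
    case (Cons z ys)
    then have xs_eq: "xs = B @ replicate m 1 @ 0 # ys" using hd_R xs_eq A_eq by simp
    have "ys = [] \<or> last ys \<noteq> 1" using less.prems unfolding xs_eq by (auto split: if_splits)
    then have "P ys" by (intro less.IH) (simp_all add: xs_eq)
    then show ?thesis unfolding xs_eq by (rule zero[OF trimmed])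
  qed
qed

lemma trailing_ones_append:
  assumes "B = [] \<or> last B \<noteq> 1"
  shows "trailing_ones (B @ replicate m 1) = replicate m 1"
    and "drop_trailing_ones (B @ replicate m 1) = B"
proof -
  have "takeWhile (\<lambda>x. x = 1) (rev B) = []" "dropWhile (\<lambda>x. x = 1) (rev B) = rev B"
    using assms by (cases B rule: rev_cases; simp)+
  then show "trailing_ones (B @ replicate m 1) = replicate m 1"
    "drop_trailing_ones (B @ replicate m 1) = B"
    by (simp_all add: trailing_ones_def drop_trailing_ones_def takeWhile_append dropWhile_append)
qed

lemma phi_maximal_block:
  assumes "A \<noteq> []" "\<forall>x\<in>set A. 0 < x" "R = [] \<or> hd R = 0"
  shows "phi (A @ R) =
    (if R = [] then shift_unit (drop_trailing_ones A) @ trailing_ones A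
     else shift_unit (drop_trailing_ones A) @ [0] @ trailing_ones A @ phi (tl R))"
proof -
  have split_A_R: "takeWhile (\<lambda>y. y > 0) (A @ R) = A" "dropWhile (\<lambda>y. y > 0) (A @ R) = R"
    using assms by (cases R; simp add: takeWhile_append dropWhile_append)+
  obtain x A' where "A = Suc x # A'"
    using assms(1,2) by (metis list.set_intros(1) neq_Nil_conv not0_implies_Suc less_irrefl)
  then have "A @ R = Suc x # (A' @ R)" by simp
  then show ?thesis
    using phi.simps(3)[of x "A' @ R"] split_A_R by (simp add: Let_def)
qed

lemma phi_block:
  assumes "trimmed_block B"
  shows "phi B = shift_unit B"
  using assms phi_maximal_block[of B "[]"] trailing_ones_append[of B 0]
  by (cases "B = []") (simp_all add: trimmed_block_def shift_unit_def)

lemma phi_block_zero: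
  assumes "trimmed_block B"
  shows "phi (B @ replicate m 1 @ 0 # ys) = shift_unit B @ 0 # replicate m 1 @ phi ys"
proof (cases "B @ replicate m 1 = []")
  case True
  then show ?thesis by (simp add: shift_unit_def)
next
  case False
  then show ?thesis
    using assms phi_maximal_block[OF False, of "0 # ys"] trailing_ones_append[of B m]
    by (simp add: trimmed_block_def set_replicate_conv_if)
qed

lemma phi_from_ones_then_zero:
  "phi_from p f (replicate m 1 @ 0 # xs) = of_bool p # replicate m 1 @ phi_from False True xs"
  using ones_then_zero_replicate by (induction m arbitrary: p f) auto

lemma phi_from_trimmed_block_rest:
  assumes "trimmed_block B" "B \<noteq> []" "ones_then_zero xs"
  shows "phi_from p False (B @ xs) = butlast B @ [last B - 1] @ phi_from False True xs"
  using assms(1,2)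
proof (induction B arbitrary: p)
  case (Cons x B)
  show ?case
  proof (cases "B = []")
    case True
    then show ?thesis
      using Cons.prems assms(3) by (cases xs) (auto simp: trimmed_block_Cons)
  next
    case False
    then show ?thesis
      using Cons not_ones_then_zero_trimmed_block[of B xs] by (simp add: trimmed_block_Cons)
  qed
qed simp

lemma phi_from_trimmed_block:
  assumes "trimmed_block B" "ones_then_zero xs"
  shows "phi_from False True (B @ xs) = shift_unit B @ phi_from False True xs"
proof (cases B)
  case Nil
  then show ?thesis by (simp add: shift_unit_def)
next
  case (Cons x B')
  show ?thesis
  proof (cases "B' = []")
    case True
    then show ?thesis
      using Cons assms by (cases xs) (auto simp: trimmed_block_Cons shift_unit_def)
  next
    case False
    then have "2 \<le> length B" "trimmed_block B'"
      using Cons assms(1) by (auto simp: trimmed_block_Cons Suc_le_eq)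
    then show ?thesis
      using Cons False assms not_ones_then_zero_trimmed_block[of B' xs]
        phi_from_trimmed_block_rest[of B' xs]
      by (simp add: trimmed_block_Cons shift_unit_def)
  qed
qed

lemma phi_eq_phi_from: "xs = [] \<or> last xs \<noteq> 1 \<Longrightarrow> phi xs = phi_from False True xs"
proof (induction xs rule: sequence_block_induct)
  case (block B)
  then show ?case using phi_from_trimmed_block[of B "[]"] by (simp add: phi_block)
next
  case (zero B m ys)
  then show ?case
    using phi_from_trimmed_block[OF zero(1) ones_then_zero_replicate, of m ys]
    by (simp add: phi_block_zero phi_from_ones_then_zero del: One_nat_def)
qed

lemma factors_cong:
  "(\<And>j. i < j \<Longrightarrow> j < i + length xs \<Longrightarrow> c j = c' j) \<Longrightarrow> factors c i xs = factors c' i xs"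
  by (induction c i xs rule: factors.induct) (auto simp: Let_def)

lemma factors_map_upt:
  assumes "Suc i < n"
  shows "factors c i (map d [i..<n]) =
    (let fs = factors c (Suc i) (map d [Suc i..<n])
     in if c (Suc i) then [d i] # fs else (d i # hd fs) # tl fs)"
proof -
  have "[i..<n] = i # Suc i # [Suc (Suc i)..<n]" "[Suc i..<n] = Suc i # [Suc (Suc i)..<n]"
    using assms by (simp_all add: upt_rec)
  then show ?thesis by simp
qed

text \<open>
  The end \<open>n\<close> of the range counts as a cut, so that no factor ends in \<open>1\<close>.
\<close>

definition no_one_before_cut :: "(nat \<Rightarrow> bool) \<Rightarrow> (nat \<Rightarrow> nat) \<Rightarrow> nat \<Rightarrow> nat \<Rightarrow> bool" where
  "no_one_before_cut c d m n \<longleftrightarrow> c n \<and> (\<forall>i\<in>{m..<n}. d i = 1 \<longrightarrow> \<not> c (Suc i))"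

lemma no_one_before_cut_Suc: "no_one_before_cut c d m n \<Longrightarrow> no_one_before_cut c d (Suc m) n"
  by (simp add: no_one_before_cut_def)

lemma factors_not_Nil: "m < n \<Longrightarrow> factors c m (map d [m..<n]) \<noteq> []"
  by (induction m rule: strict_inc_induct) (auto simp: factors_map_upt Let_def)

lemma factor_not_ends_in_one:
  assumes "m < n" "no_one_before_cut c d m n" "F \<in> set (factors c m (map d [m..<n]))"
  shows "F \<noteq> [] \<and> last F \<noteq> 1"
  using assms
proof (induction m arbitrary: F rule: strict_inc_induct)
  case (base m)
  then show ?case by (auto simp: no_one_before_cut_def)
next
  case (step m)
  have IH: "F \<noteq> [] \<and> last F \<noteq> 1" if "F \<in> set (factors c (Suc m) (map d [Suc m..<n]))" for F
    using step.IH step.prems(1) that no_one_before_cut_Suc by blast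
  obtain G Gs where "factors c (Suc m) (map d [Suc m..<n]) = G # Gs"
    using factors_not_Nil[OF step.hyps, of c d] by (meson neq_Nil_conv)
  then show ?case
    using IH step.prems step.hyps
    by (auto simp: factors_map_upt no_one_before_cut_def Let_def split: if_splits)
qed

lemma ones_then_zero_map_upt:
  assumes "m < n"
  shows "ones_then_zero (map d [m..<n]) \<longleftrightarrow> d m = 0 \<or> d m = 1 \<and> ones_then_zero (map d [Suc m..<n])"
  using assms by (simp add: upt_rec)

lemma ones_then_zero_hd_factors:
  assumes "m < n" "no_one_before_cut c d m n"
  shows "ones_then_zero (hd (factors c m (map d [m..<n]))) = ones_then_zero (map d [m..<n])"
  using assms
proof (induction m rule: strict_inc_induct)
  case (step m)
  then have "d m = 1 \<Longrightarrow> \<not> c (Suc m)" by (simp add: no_one_before_cut_def)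
  moreover have "ones_then_zero (map d [m..<n]) \<longleftrightarrow>
      d m = 0 \<or> d m = 1 \<and> ones_then_zero (map d [Suc m..<n])"
    using step.hyps by (intro ones_then_zero_map_upt) simp
  ultimately show ?case
    using step.IH[OF no_one_before_cut_Suc[OF step.prems]]
    by (auto simp: factors_map_upt[OF step.hyps] Let_def)
qed simp

text \<open>The predicate \<open>t\<close> marks the run positions.\<close>

definition phi_entry :: "(nat \<Rightarrow> bool) \<Rightarrow> (nat \<Rightarrow> bool) \<Rightarrow> (nat \<Rightarrow> nat) \<Rightarrow> nat \<Rightarrow> nat" where
  "phi_entry c t d i =
    (if t i then of_bool (\<not> c i \<and> d (i - 1) = 1)
     else d i + of_bool (c i \<or> t (i - 1)) - of_bool (c (i + 1) \<or> t (i + 1)))"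

lemma phi_from_factors:
  fixes d :: "nat \<Rightarrow> nat"
  assumes "m < n" "no_one_before_cut c d m n"
    and "\<And>i. m \<le> i \<Longrightarrow> t i = ones_then_zero (map d [i..<n])"
    and "p \<longleftrightarrow> \<not> c m \<and> d (m - 1) = 1" and "f \<longleftrightarrow> c m \<or> t (m - 1)"
  defines "fs \<equiv> factors c m (map d [m..<n])"
  shows "phi_from p f (hd fs) @ concat (map (phi_from False True) (tl fs))
    = map (phi_entry c t d) [m..<n]"
  unfolding fs_def using assms(1-5)
proof (induction m arbitrary: p f rule: strict_inc_induct)
  case (base m)
  then show ?case by (auto simp: phi_entry_def no_one_before_cut_def)
next
  case (step m)
  let ?fs = "factors c (Suc m) (map d [Suc m..<n])"
  have IH: "phi_from (\<not> c (Suc m) \<and> d m = 1) (c (Suc m) \<or> t m) (hd ?fs)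
      @ concat (map (phi_from False True) (tl ?fs)) = map (phi_entry c t d) [Suc m..<n]"
    using step no_one_before_cut_Suc[OF step.prems(1)] by simp
  have hd_fs: "ones_then_zero (hd ?fs) = t (Suc m)"
    using ones_then_zero_hd_factors[OF step.hyps no_one_before_cut_Suc[OF step.prems(1)]]
      step.prems(2)[of "Suc m"] by simp
  have t_rec: "t m \<longleftrightarrow> d m = 0 \<or> d m = 1 \<and> t (Suc m)"
    using step.prems(2)[of m] step.prems(2)[of "Suc m"] step.hyps ones_then_zero_map_upt[of m n d]
    by simp
  have upt_m: "[m..<n] = m # [Suc m..<n]" using step.hyps by (simp add: upt_rec)
  have fs_Cons: "?fs = hd ?fs # tl ?fs" using factors_not_Nil[OF step.hyps, of c d] by simp
  show ?case
  proof (cases "c (Suc m)")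
    case True
    then have "d m \<noteq> 1" using step.prems(1) step.hyps by (auto simp: no_one_before_cut_def)
    then have "phi_from p f [d m] = [phi_entry c t d m]"
      using True t_rec step.prems(3,4) by (simp add: phi_entry_def)
    moreover have "concat (map (phi_from False True) ?fs) = map (phi_entry c t d) [Suc m..<n]"
      using IH True by (subst fs_Cons) simp
    ultimately show ?thesis
      using True unfolding factors_map_upt[OF step.hyps] Let_def unfolding upt_m by simp
  next
    case False
    then have "phi_from p f (d m # hd ?fs) =
        phi_entry c t d m # phi_from (d m = 1) (c (Suc m) \<or> t m) (hd ?fs)"
      using t_rec hd_fs step.prems(3,4) by (simp add: phi_entry_def)
    then show ?thesis
      using False IH unfolding factors_map_upt[OF step.hyps] Let_def unfolding upt_m by simp
  qed
qed

lemma concat_phi_factors: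
  fixes d :: "nat \<Rightarrow> nat"
  assumes "m \<le> n" "c m" "no_one_before_cut c d m n"
  defines "t \<equiv> \<lambda>i. ones_then_zero (map d [i..<n])"
  shows "concat (map phi (factors c m (map d [m..<n]))) = map (phi_entry c t d) [m..<n]"
proof (cases "m = n")
  case False
  let ?fs = "factors c m (map d [m..<n])"
  have m_less: "m < n" using False assms(1) by simp
  have "map phi ?fs = map (phi_from False True) ?fs"
    using factor_not_ends_in_one[OF m_less assms(3)] by (intro map_cong refl phi_eq_phi_from) blast
  moreover have "?fs = hd ?fs # tl ?fs" using factors_not_Nil[OF m_less, of c d] by simp
  moreover have "phi_from False True (hd ?fs) @ concat (map (phi_from False True) (tl ?fs))
      = map (phi_entry c t d) [m..<n]"
    using assms by (intro phi_from_factors[OF m_less]) simp_all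
  ultimately show ?thesis by (metis concat.simps(2) list.simps(9))
qed simp

text \<open>
  The positions marked by \<open>t\<close> are those from which \<open>d\<close> reads \<open>1, \<dots>, 1, 0\<close> and also those up to
  which \<open>e\<close> reads \<open>0, 1, \<dots>, 1\<close>. The conditions are invariant under exchanging \<open>d\<close> and \<open>e\<close> and
  reading the sequences backwards.
\<close>

definition phi_graph_at ::
    "(nat \<Rightarrow> bool) \<Rightarrow> (nat \<Rightarrow> bool) \<Rightarrow> (nat \<Rightarrow> nat) \<Rightarrow> (nat \<Rightarrow> nat) \<Rightarrow> nat \<Rightarrow> bool" where
  "phi_graph_at c t d e i \<longleftrightarrow>
     (d i = 1 \<longrightarrow> \<not> c (i + 1)) \<and> (t i \<longleftrightarrow> d i = 0 \<or> d i = 1 \<and> t (i + 1)) \<and>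
     (e i = 1 \<longrightarrow> \<not> c i) \<and> (t i \<longleftrightarrow> e i = 0 \<or> e i = 1 \<and> t (i - 1)) \<and>
     (t i \<longrightarrow> d i = of_bool (\<not> c (i + 1) \<and> e (i + 1) = 1)) \<and>
     (t i \<longrightarrow> e i = of_bool (\<not> c i \<and> d (i - 1) = 1)) \<and>
     (\<not> t i \<longrightarrow> d i + of_bool (c i \<or> t (i - 1)) = e i + of_bool (c (i + 1) \<or> t (i + 1)))"

definition phi_graph ::
    "nat \<Rightarrow> (nat \<Rightarrow> bool) \<Rightarrow> (nat \<Rightarrow> bool) \<Rightarrow> (nat \<Rightarrow> nat) \<Rightarrow> (nat \<Rightarrow> nat) \<Rightarrow> bool" where
  "phi_graph l c t d e \<longleftrightarrow> c 1 \<and> c (l + 1) \<and> (\<forall>i\<in>{1..l}. phi_graph_at c t d e i)"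

lemma
  assumes "phi_graph l c t d e"
  shows phi_graph_cut_first: "c 1"
    and phi_graph_cut_last: "c (l + 1)"
    and phi_graph_one_before_cut: "i \<in> {1..l} \<Longrightarrow> d i = 1 \<Longrightarrow> \<not> c (i + 1)"
    and phi_graph_run_iff_dom: "i \<in> {1..l} \<Longrightarrow> t i \<longleftrightarrow> d i = 0 \<or> d i = 1 \<and> t (i + 1)"
    and phi_graph_one_after_cut: "i \<in> {1..l} \<Longrightarrow> e i = 1 \<Longrightarrow> \<not> c i"
    and phi_graph_run_iff_img: "i \<in> {1..l} \<Longrightarrow> t i \<longleftrightarrow> e i = 0 \<or> e i = 1 \<and> t (i - 1)"
    and phi_graph_img_at_run:
      "i \<in> {1..l} \<Longrightarrow> t i \<Longrightarrow> e i = of_bool (\<not> c i \<and> d (i - 1) = 1)"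
    and phi_graph_not_at_run:
      "i \<in> {1..l} \<Longrightarrow> \<not> t i \<Longrightarrow>
        d i + of_bool (c i \<or> t (i - 1)) = e i + of_bool (c (i + 1) \<or> t (i + 1))"
  using assms unfolding phi_graph_def phi_graph_at_def by blast+

lemma phi_entry_not_at_run:
  assumes "\<not> t i" "t i \<longleftrightarrow> d i = 0 \<or> d i = 1 \<and> t (i + 1)" "d i = 1 \<Longrightarrow> \<not> c (i + 1)"
  shows "d i + of_bool (c i \<or> t (i - 1)) = phi_entry c t d i + of_bool (c (i + 1) \<or> t (i + 1))"
    and "0 < phi_entry c t d i"
    and "c i \<or> t (i - 1) \<Longrightarrow> 1 < phi_entry c t d i"
proof -
  have "d i \<noteq> 0" "d i = 1 \<Longrightarrow> \<not> (c (i + 1) \<or> t (i + 1))"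
    using assms by auto
  then have "1 + of_bool (c (i + 1) \<or> t (i + 1)) \<le> d i"
    by (cases "d i = 1") auto
  then show "d i + of_bool (c i \<or> t (i - 1)) = phi_entry c t d i + of_bool (c (i + 1) \<or> t (i + 1))"
    and "0 < phi_entry c t d i"
    and "c i \<or> t (i - 1) \<Longrightarrow> 1 < phi_entry c t d i"
    using assms(1) by (auto simp: phi_entry_def simp del: of_bool_or_iff)
qed

lemma phi_graphI:
  assumes cuts: "c 1" "no_one_before_cut c d 1 (l + 1)"
    and run_rec: "\<And>i. i \<in> {1..l} \<Longrightarrow> t i \<longleftrightarrow> d i = 0 \<or> d i = 1 \<and> t (i + 1)"
    and e_eq: "\<And>i. i \<in> {1..l} \<Longrightarrow> e i = phi_entry c t d i"
  shows "phi_graph l c t d e"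
proof -
  have last: "c (l + 1)" and no_one: "i \<in> {1..l} \<Longrightarrow> d i = 1 \<Longrightarrow> \<not> c (i + 1)" for i
    using cuts(2) by (auto simp: no_one_before_cut_def)
  have run: "e i = of_bool (\<not> c i \<and> d (i - 1) = 1)" if "i \<in> {1..l}" "t i" for i
    using e_eq that by (simp add: phi_entry_def)
  have block: "d i + of_bool (c i \<or> t (i - 1)) = e i + of_bool (c (i + 1) \<or> t (i + 1))"
      "0 < e i" "c i \<or> t (i - 1) \<Longrightarrow> 1 < e i" if "i \<in> {1..l}" "\<not> t i" for i
    using phi_entry_not_at_run[of t i d c, OF that(2) run_rec[OF that(1)] no_one[OF that(1)]]
    unfolding e_eq[OF that(1)] by blast+
  have "e i = 1 \<longrightarrow> \<not> c i" if "i \<in> {1..l}" for i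
    using run[OF that] block(3)[OF that] by (cases "t i") auto
  moreover have "t i \<longleftrightarrow> e i = 0 \<or> e i = 1 \<and> t (i - 1)" if i: "i \<in> {1..l}" for i
  proof (cases "t i")
    case True
    have "t (i - 1)" if "\<not> c i" "d (i - 1) = 1"
    proof -
      have "i - 1 \<in> {1..l}" using that(1) cuts(1) i by (cases "i = 1") auto
      then show ?thesis using run_rec[of "i - 1"] that(2) True i by simp
    qed
    then show ?thesis using run[OF i True] True by auto
  next
    case False
    then show ?thesis using block(2,3)[OF i False] by auto
  qed
  moreover have "d i = of_bool (\<not> c (i + 1) \<and> e (i + 1) = 1)" if i: "i \<in> {1..l}" "t i" for i
  proof (cases "c (i + 1)")
    case True
    then show ?thesis using run_rec[OF i(1)] i(2) no_one[OF i(1)] by auto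
  next
    case False
    then have succ: "i + 1 \<in> {1..l}" using last i(1) by (cases "i = l") auto
    then have "e (i + 1) = 1 \<longleftrightarrow> d i = 1"
      using run[OF succ] block(3)[OF succ] i run_rec[OF i(1)] False
      by (cases "t (i + 1)") auto
    then show ?thesis using run_rec[OF i(1)] i(2) False by auto
  qed
  ultimately show ?thesis
    unfolding phi_graph_def phi_graph_at_def
    using cuts(1) last no_one run_rec run block(1) by blast
qed

lemma phi_graph_concat_phi_factors:
  fixes d :: "nat \<Rightarrow> nat"
  assumes "c 1" "no_one_before_cut c d 1 (l + 1)"
  defines "t \<equiv> \<lambda>i. ones_then_zero (map d [i..<l + 1])"
  shows "phi_graph l c t d (\<lambda>i. concat (map phi (factors c 1 (map d [1..<l + 1]))) ! (i - 1))"
proof (rule phi_graphI[OF assms(1,2)])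
  fix i assume i: "i \<in> {1..l}"
  then show "t i \<longleftrightarrow> d i = 0 \<or> d i = 1 \<and> t (i + 1)"
    using ones_then_zero_map_upt[of i "l + 1" d] by (simp add: t_def)
  show "concat (map phi (factors c 1 (map d [1..<l + 1]))) ! (i - 1) = phi_entry c t d i"
    using i concat_phi_factors[OF _ assms(1,2)] nth_map_upt[of "i - 1" "l + 1" 1 "phi_entry c t d"]
    unfolding t_def by (auto simp del: upt_Suc)
qed

definition mirror :: "nat \<Rightarrow> (nat \<Rightarrow> 'a) \<Rightarrow> nat \<Rightarrow> 'a" where
  "mirror n f i = f (n + 1 - i)"

definition mirrored :: "nat \<Rightarrow> (nat \<Rightarrow> 'a) \<Rightarrow> (nat \<Rightarrow> 'a) \<Rightarrow> bool" where
  "mirrored n f g \<longleftrightarrow> (\<forall>i\<in>{1..n}. g i = mirror n f i)"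

lemma mirroredD: "mirrored n f g \<Longrightarrow> i \<in> {1..n} \<Longrightarrow> g i = f (n + 1 - i)"
  by (simp add: mirrored_def mirror_def)

lemma mirrored_mirror: "mirrored n f (mirror n f)"
  by (simp add: mirrored_def)

lemma mirrored_sym:
  assumes "mirrored n f g"
  shows "mirrored n g f"
  unfolding mirrored_def mirror_def
proof
  fix i assume i: "i \<in> {1..n}"
  then have "n + 1 - i \<in> {1..n}" by auto
  then show "f i = g (n + 1 - i)"
    using mirroredD[OF assms, of "n + 1 - i"] i by simp
qed

lemma phi_graph_mirror:
  assumes graph: "phi_graph l c t d e" and mirrored: "mirrored (l + 1) c c'"
  shows "phi_graph l c' (mirror l t) (mirror l e) (mirror l d)"
  unfolding phi_graph_def
proof (intro conjI ballI)
  show "c' 1" "c' (l + 1)"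
    using phi_graph_cut_first[OF graph] phi_graph_cut_last[OF graph] mirroredD[OF mirrored]
    by simp_all
next
  fix i assume i: "i \<in> {1..l}"
  define k where "k = l + 1 - i"
  have index_eqs: "l + 1 - i = k" "l + 1 - (i - 1) = k + 1" "l + 1 - (i + 1) = k - 1"
    using i by (auto simp: k_def)
  have c'_eqs: "c' i = c (k + 1)" "c' (i + 1) = c k"
    using i mirroredD[OF mirrored, of i] mirroredD[OF mirrored, of "i + 1"]
    by (auto simp: k_def Suc_diff_le)
  have "k \<in> {1..l}" using i by (auto simp: k_def)
  then show "phi_graph_at c' (mirror l t) (mirror l e) (mirror l d) i"
    using graph unfolding phi_graph_def phi_graph_at_def mirror_def index_eqs c'_eqs by metis
qed

lemma phi_graph_run_eq:
  assumes "phi_graph l c t d e" "phi_graph l c' t' d' e'"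
    and dom_eq: "\<And>i. i \<in> {1..l} \<Longrightarrow> d i = d' i" and "1 \<le> i" "i \<le> l"
  shows "t i = t' i"
proof -
  note run_iff = phi_graph_run_iff_dom[OF assms(1)] phi_graph_run_iff_dom[OF assms(2)]
  show ?thesis
    using assms(5,4)
  proof (induction i rule: inc_induct)
    case base
    then show ?case
      using phi_graph_cut_last[OF assms(1)] phi_graph_one_before_cut[OF assms(1), of l]
        run_iff[of l] dom_eq[of l] by auto
  next
    case (step i)
    then show ?case using run_iff[of i] dom_eq[of i] by auto
  qed
qed

lemma phi_graph_functional:
  assumes "phi_graph l c t d e" "phi_graph l c' t' d' e'"
    and cut_eq: "\<And>j. j \<in> {1..l + 1} \<Longrightarrow> c j = c' j" and dom_eq: "\<And>i. i \<in> {1..l} \<Longrightarrow> d i = d' i"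
    and i: "i \<in> {1..l}"
  shows "e i = e' i"
proof -
  note run_eq = phi_graph_run_eq[OF assms(1,2) dom_eq]
  have "i = 1 \<or> t (i - 1) = t' (i - 1) \<and> d (i - 1) = d' (i - 1)"
    using run_eq[of "i - 1"] dom_eq[of "i - 1"] i by force
  then have before: "(c i \<or> t (i - 1)) = (c' i \<or> t' (i - 1))"
      "(\<not> c i \<and> d (i - 1) = 1) = (\<not> c' i \<and> d' (i - 1) = 1)"
    using phi_graph_cut_first[OF assms(1)] cut_eq[of i] i by auto
  have "i = l \<or> t (i + 1) = t' (i + 1)"
    using run_eq[of "i + 1"] i by force
  then have after: "(c (i + 1) \<or> t (i + 1)) = (c' (i + 1) \<or> t' (i + 1))"
    using phi_graph_cut_last[OF assms(1)] cut_eq[of "i + 1"] i by auto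
  have run_eq_i: "t i = t' i" using run_eq i by simp
  show ?thesis
  proof (cases "t i")
    case True
    then show ?thesis
      using phi_graph_img_at_run[OF assms(1) i] phi_graph_img_at_run[OF assms(2) i]
        run_eq_i before(2)
      by simp
  next
    case False
    then show ?thesis
      using phi_graph_not_at_run[OF assms(1) i] phi_graph_not_at_run[OF assms(2) i]
        run_eq_i dom_eq[OF i] before(1) after
      by (simp del: of_bool_or_iff)
  qed
qed

lemma sum_phi_graph:
  assumes "phi_graph l c t d e"
  shows "sum e {1..l} = sum d {1..l}"
proof -
  \<comment> \<open>the number of units that the map moves from position \<open>i\<close> back to position \<open>i - 1\<close>\<close>
  define flow :: "nat \<Rightarrow> int" where
    "flow i = of_bool (\<not> c i \<and> \<not> t i \<and> \<not> t (i - 1)) - of_bool (\<not> c i \<and> t i \<and> d (i - 1) = 1)"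
    for i
  have "int (e i) - int (d i) = flow (Suc i) - flow i" if i: "i \<in> {1..l}" for i
  proof (cases "t i")
    case True
    have "flow (Suc i) = - int (d i)"
      using True phi_graph_one_before_cut[OF assms i] phi_graph_run_iff_dom[OF assms i]
      by (auto simp: flow_def)
    moreover have "flow i = - int (e i)"
      using True phi_graph_img_at_run[OF assms i] by (simp add: flow_def)
    ultimately show ?thesis by simp
  next
    case False
    have "flow (Suc i) = 1 - of_bool (c (i + 1) \<or> t (i + 1))"
      using False phi_graph_run_iff_dom[OF assms i] by (auto simp: flow_def)
    moreover have "flow i = 1 - of_bool (c i \<or> t (i - 1))"
      using False by (auto simp: flow_def)
    moreover have "int (d i) + of_bool (c i \<or> t (i - 1))
        = int (e i) + of_bool (c (i + 1) \<or> t (i + 1))"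
      using phi_graph_not_at_run[OF assms i False] by (metis of_nat_add of_nat_of_bool)
    ultimately show ?thesis by simp
  qed
  then have "(\<Sum>i=1..l. int (e i) - int (d i)) = flow (Suc l) - flow 1"
    using sum_Suc_diff[of 1 l flow] by simp
  also have "\<dots> = 0"
    using phi_graph_cut_first[OF assms] phi_graph_cut_last[OF assms] by (simp add: flow_def)
  finally have "int (sum e {1..l}) = int (sum d {1..l})" by (simp add: sum_subtractf)
  then show ?thesis by (simp only: of_nat_eq_iff)
qed

section \<open>The fence as a sequence of intervals\<close>

lemma up_closed_eq_atLeastLessThan:
  fixes X :: "nat set"
  assumes "X \<subseteq> {m..<n}" "\<And>x y. x \<in> X \<Longrightarrow> x \<le> y \<Longrightarrow> y < n \<Longrightarrow> y \<in> X"
  shows "X = {n - card X..<n}"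
proof (cases "X = {}")
  case False
  have "finite X" using assms(1) finite_subset by blast
  then obtain k where k_min: "k \<in> X" "\<And>x. x \<in> X \<Longrightarrow> k \<le> x"
    using False by (metis Min_in Min_le)
  then have "X = {k..<n}" using assms(1) assms(2)[OF k_min(1)] by auto
  moreover from this have "n - card X = k"
    using k_min(1) by (metis atLeastLessThan_iff card_atLeastLessThan diff_diff_cancel less_imp_le)
  ultimately show ?thesis by simp
qed simp

lemma down_closed_eq_atLeastLessThan:
  fixes X :: "nat set"
  assumes "X \<subseteq> {m..<n}" "\<And>x y. x \<in> X \<Longrightarrow> m \<le> y \<Longrightarrow> y \<le> x \<Longrightarrow> y \<in> X"
  shows "X = {m..<m + card X}"
proof (cases "X = {}")
  case False
  have "finite X" using assms(1) finite_subset by blast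
  then obtain k where k_max: "k \<in> X" "\<And>x. x \<in> X \<Longrightarrow> x \<le> k"
    using False by (metis Max_in Max_ge)
  then have "X \<subseteq> {m..<Suc k}" using assms(1) by (auto simp: less_Suc_eq_le)
  moreover have "{m..<Suc k} \<subseteq> X" using assms(2)[OF k_max(1)] by auto
  ultimately have "X = {m..<Suc k}" by (rule equalityI)
  moreover from this have "m + card X = Suc k"
    using k_max(1) by (metis atLeastLessThan_iff card_atLeastLessThan le_add_diff_inverse le_SucI)
  ultimately show ?thesis by simp
qed simp

lemma card_Int_lessThan_add:
  fixes X :: "nat set"
  assumes "a \<le> b"
  shows "card (X \<inter> {..<b}) = card (X \<inter> {..<a}) + card (X \<inter> {a..<b})"
proof -
  have "X \<inter> {..<b} = (X \<inter> {..<a}) \<union> (X \<inter> {a..<b})" using assms by auto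
  then show ?thesis by (simp add: card_Un_disjoint disjoint_iff)
qed

lemma card_Int_alternating_intervals:
  fixes X :: "nat set" and n :: nat
  assumes "q 0 = 0" "\<forall>j\<in>{1..n + 1}. q (j - 1) \<le> p j" "\<forall>i\<in>{1..n}. p i \<le> q i"
  shows "card (X \<inter> {..<p (n + 1)})
    = (\<Sum>j=1..n + 1. card (X \<inter> {q (j - 1)..<p j})) + (\<Sum>i=1..n. card (X \<inter> {p i..<q i}))"
  using assms(2,3)
proof (induction n)
  case 0
  then show ?case by (simp add: assms(1) atLeast0LessThan)
next
  case (Suc n)
  have q_le: "q (n + 1) \<le> p (n + 2)" using bspec[OF Suc.prems(1), of "n + 2"] by simp
  have "card (X \<inter> {..<p (n + 2)})
      = card (X \<inter> {..<p (n + 1)}) + card (X \<inter> {p (n + 1)..<q (n + 1)})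
        + card (X \<inter> {q (n + 1)..<p (n + 2)})"
    using q_le Suc.prems
      card_Int_lessThan_add[of "p (n + 1)" "q (n + 1)" X]
      card_Int_lessThan_add[of "q (n + 1)" "p (n + 2)" X]
    by simp
  then show ?case using Suc.IH Suc.prems by simp
qed

text \<open>
  \<open>peak \<beta> i\<close> is the common maximum of \<open>A\<^sub>i\<close> and \<open>D\<^sub>i\<close>, and \<open>past_valley \<beta> i\<close> is the number
  following the common minimum of \<open>D\<^sub>i\<close> and \<open>A\<^bsub>i+1\<^esub>\<close>. The conventions at the two ends make the
  unshared part of every \<open>A\<^sub>j\<close> the half-open interval from \<open>past_valley \<beta> (j - 1)\<close> to \<open>peak \<beta> j\<close>.
\<close>

definition peak :: "nat list \<Rightarrow> nat \<Rightarrow> nat" where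
  "peak \<beta> j = junction \<beta> (2 * j - 1) + of_bool (j = ell \<beta> + 1)"

definition past_valley :: "nat list \<Rightarrow> nat \<Rightarrow> nat" where
  "past_valley \<beta> i = junction \<beta> (2 * i) + of_bool (i \<noteq> 0)"

definition cap :: "nat list \<Rightarrow> nat \<Rightarrow> nat" where
  "cap \<beta> j = card (asc_unshared \<beta> j)"

lemma alpha_minus_one: "alpha \<beta> j - 1 = cap \<beta> j"
  by (simp add: alpha_def cap_def)

lemma junction_0: "junction \<beta> 0 = 0"
  by (simp add: junction_def)

lemma past_valley_0: "past_valley \<beta> 0 = 0"
  by (simp add: past_valley_def junction_0)

lemma junction_length: "junction \<beta> (length \<beta>) = sum_list \<beta>"
  by (simp add: junction_def)

lemma shared_junction:
  assumes "1 \<le> i" "i < length \<beta>"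
  shows "shared \<beta> (junction \<beta> i)"
proof -
  have "junction \<beta> i \<in> segment \<beta> i" "junction \<beta> i \<in> segment \<beta> (Suc i)"
    using segment_Int_Suc[OF assms(1), of \<beta>] by auto
  then show ?thesis
    unfolding shared_def using assms by (intro bexI[of _ i] bexI[of _ "Suc i"]) auto
qed

locale odd_composition =
  fixes \<beta> :: "nat list"
  assumes pos: "\<forall>x\<in>set \<beta>. 0 < x" and odd_length: "odd (length \<beta>)"
begin

lemma length_eq: "length \<beta> = 2 * ell \<beta> + 1"
  using odd_length unfolding ell_def by presburger

lemma past_valley_le_peak:
  assumes "i < j" "j \<le> ell \<beta> + 1"
  shows "past_valley \<beta> i \<le> peak \<beta> j"
proof -
  have "past_valley \<beta> i \<le> junction \<beta> (2 * i) + 1"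
    by (simp add: past_valley_def)
  also have "\<dots> \<le> junction \<beta> (2 * j - 1)"
    using junction_strict_mono[OF pos, of "2 * i" "2 * j - 1"] assms length_eq by fastforce
  also have "\<dots> \<le> peak \<beta> j"
    by (simp add: peak_def)
  finally show ?thesis .
qed

lemma peak_less_past_valley:
  assumes "1 \<le> i" "i \<le> j" "j \<le> ell \<beta>"
  shows "peak \<beta> i < past_valley \<beta> j"
  using assms junction_mono[of "2 * i - 1" "2 * j" \<beta>]
  by (simp add: peak_def past_valley_def less_Suc_eq_le)

lemma peak_last: "peak \<beta> (ell \<beta> + 1) = Suc (sum_list \<beta>)"
  using junction_length[of \<beta>] length_eq by (simp add: peak_def)

lemma fence_eq_lessThan: "fence \<beta> = {..<peak \<beta> (ell \<beta> + 1)}"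
proof -
  have "\<beta> \<noteq> []" using odd_length by auto
  then show ?thesis
    unfolding peak_last by (simp add: fence_eq lessThan_Suc_atMost atLeast0AtMost)
qed

lemma shared_iff:
  assumes "k \<in> {1..length \<beta>}" "x \<in> segment \<beta> k"
  shows "shared \<beta> x \<longleftrightarrow> 1 < k \<and> x = junction \<beta> (k - 1) \<or> k < length \<beta> \<and> x = junction \<beta> k"
    (is "_ \<longleftrightarrow> ?end_point")
proof
  assume "shared \<beta> x"
  then obtain k' where k': "k' \<in> {1..length \<beta>}" "k' \<noteq> k" "x \<in> segment \<beta> k'"
    unfolding shared_def by metis
  consider (after) "k' = Suc k" | (before) "k = Suc k'"
    | (right) "Suc k < k'" | (left) "Suc k' < k"
    using k'(2) by linarith
  then show ?end_point
  proof cases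
    case after
    then show ?thesis using segment_Int_Suc[of k \<beta>] assms k' by auto
  next
    case before
    then show ?thesis using segment_Int_Suc[of k' \<beta>] assms k' by auto
  next
    case right
    then show ?thesis using segment_disjoint[OF pos _ right] assms k' by auto
  next
    case left
    then show ?thesis using segment_disjoint[OF pos _ left] assms k' by auto
  qed
next
  assume ?end_point
  then show "shared \<beta> x" using assms(1) by (auto intro: shared_junction)
qed

lemma desc_eq: "i \<in> {1..ell \<beta>} \<Longrightarrow> desc \<beta> i = {peak \<beta> i..<past_valley \<beta> i}"
  by (auto simp: desc_def segment_def peak_def past_valley_def)

lemma asc_eq:
  assumes "j \<in> {1..ell \<beta> + 1}"
  shows "asc \<beta> j = fence \<beta> \<inter> {x. past_valley \<beta> (j - 1) \<le> Suc x \<and> x \<le> peak \<beta> j}"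
proof -
  have "2 * j - 1 - 1 = 2 * (j - 1)" "2 * j - 1 \<le> length \<beta>" using assms length_eq by auto
  then show ?thesis
    using junction_mono[of "2 * j - 1" "length \<beta>" \<beta>] junction_length[of \<beta>] peak_last assms
    unfolding fence_eq_lessThan
    by (auto simp: asc_def segment_def peak_def past_valley_def junction_0)
qed

lemma asc_unshared_eq:
  assumes "j \<in> {1..ell \<beta> + 1}"
  shows "asc_unshared \<beta> j = {past_valley \<beta> (j - 1)..<peak \<beta> j}"
proof -
  have index: "2 * j - 1 \<in> {1..length \<beta>}" "2 * j - 1 - 1 = 2 * (j - 1)"
    "1 < 2 * j - 1 \<longleftrightarrow> j - 1 \<noteq> 0" "2 * j - 1 < length \<beta> \<longleftrightarrow> j \<noteq> ell \<beta> + 1"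
    using assms length_eq by auto
  define m n where "m = junction \<beta> (2 * (j - 1))" and "n = junction \<beta> (2 * j - 1)"
  have asc_j: "asc \<beta> j = {m..n}"
    unfolding asc_def segment_def index(2) m_def n_def by (rule refl)
  have "shared \<beta> x \<longleftrightarrow> j - 1 \<noteq> 0 \<and> x = m \<or> j \<noteq> ell \<beta> + 1 \<and> x = n" if "x \<in> asc \<beta> j" for x
    using shared_iff[OF index(1)] that unfolding asc_def index(2-4) m_def n_def by blast
  then have "asc_unshared \<beta> j = {m..n} - {x. j - 1 \<noteq> 0 \<and> x = m \<or> j \<noteq> ell \<beta> + 1 \<and> x = n}"
    unfolding asc_unshared_def asc_j by blast
  also have "\<dots> = {past_valley \<beta> (j - 1)..<peak \<beta> j}"
    unfolding peak_def past_valley_def m_def[symmetric] n_def[symmetric]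
    by (cases "j - 1 = 0"; cases "j = ell \<beta> + 1") auto
  finally show ?thesis .
qed

lemma cap_eq_diff: "j \<in> {1..ell \<beta> + 1} \<Longrightarrow> cap \<beta> j = peak \<beta> j - past_valley \<beta> (j - 1)"
  by (simp add: cap_def asc_unshared_eq)

lemma delta_eq_diff: "i \<in> {1..ell \<beta>} \<Longrightarrow> delta \<beta> i + 1 = past_valley \<beta> i - peak \<beta> i"
  using card_segment[of "2 * i" \<beta>] length_eq desc_eq[of i] by (simp add: desc_def delta_def)

lemma alpha_eq:
  assumes "j \<in> {1..ell \<beta> + 1}"
  shows "alpha \<beta> j = \<beta> ! (2 * (j - 1)) + of_bool (j = 1) + of_bool (j = ell \<beta> + 1)"
proof -
  obtain i where i: "j = Suc i" "2 * i < length \<beta>"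
    using assms length_eq by (cases j) auto
  then have "junction \<beta> (2 * j - 1) = junction \<beta> (2 * (j - 1)) + \<beta> ! (2 * (j - 1))"
    using junction_Suc[of "2 * i" \<beta>] by simp
  moreover have "0 < \<beta> ! (2 * (j - 1))"
    using i pos nth_mem by simp
  ultimately show ?thesis
    using i(1) asc_unshared_eq[OF assms] by (simp add: alpha_def peak_def past_valley_def)
qed

lemma odd_composition_rev: "odd_composition (rev \<beta>)"
  by unfold_locales (use pos odd_length in simp_all)

lemma ell_rev: "ell (rev \<beta>) = ell \<beta>"
  by (simp add: ell_def)

lemma cap_rev:
  assumes "j \<in> {1..ell \<beta> + 1}"
  shows "cap (rev \<beta>) j = cap \<beta> (ell \<beta> + 2 - j)"
proof -
  have index: "ell \<beta> + 2 - j \<in> {1..ell \<beta> + 1}" "2 * (j - 1) < length \<beta>"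
    "length \<beta> - Suc (2 * (j - 1)) = 2 * (ell \<beta> + 2 - j - 1)"
    "ell \<beta> + 2 - j = 1 \<longleftrightarrow> j = ell \<beta> + 1" "ell \<beta> + 2 - j = ell \<beta> + 1 \<longleftrightarrow> j = 1"
    using assms length_eq by auto
  show ?thesis
    using odd_composition.alpha_eq[OF odd_composition_rev, of j] assms
    unfolding alpha_minus_one[symmetric] alpha_eq[OF index(1)] ell_rev index(4,5)
      rev_nth[OF index(2)] index(3)
    by simp
qed

lemma delta_rev:
  assumes "i \<in> {1..ell \<beta>}"
  shows "delta (rev \<beta>) i = delta \<beta> (ell \<beta> + 1 - i)"
proof -
  have "2 * i - 1 < length \<beta>" "length \<beta> - Suc (2 * i - 1) = 2 * (ell \<beta> + 1 - i) - 1"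
    using assms length_eq by auto
  then show ?thesis
    by (simp add: delta_def rev_nth)
qed

lemma fence_le_iff:
  "fence_le \<beta> x y \<longleftrightarrow>
    (\<exists>j\<in>{1..ell \<beta> + 1}. x \<in> asc \<beta> j \<and> y \<in> asc \<beta> j \<and> x \<le> y) \<or>
    (\<exists>i\<in>{1..ell \<beta>}. x \<in> desc \<beta> i \<and> y \<in> desc \<beta> i \<and> y \<le> x)"
  (is "_ \<longleftrightarrow> ?in_segment")
proof
  assume "fence_le \<beta> x y"
  then obtain k where k: "k \<in> {1..length \<beta>}" "x \<in> segment \<beta> k" "y \<in> segment \<beta> k"
    "if odd k then x \<le> y else y \<le> x"
    unfolding fence_le_def by blast
  show ?in_segment
  proof (cases "even k")
    case True
    then obtain i where "k = 2 * i" by blast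
    then show ?thesis using k length_eq by (intro disjI2 bexI[of _ i]) (auto simp: desc_def)
  next
    case False
    then obtain j where "k = 2 * j + 1" by (rule oddE)
    then show ?thesis using k length_eq by (intro disjI1 bexI[of _ "j + 1"]) (auto simp: asc_def)
  qed
next
  assume ?in_segment
  then show "fence_le \<beta> x y"
  proof (elim disjE bexE)
    fix j assume "j \<in> {1..ell \<beta> + 1}" "x \<in> asc \<beta> j \<and> y \<in> asc \<beta> j \<and> x \<le> y"
    then show ?thesis
      unfolding fence_le_def asc_def using length_eq by (intro bexI[of _ "2 * j - 1"]) auto
  next
    fix i assume "i \<in> {1..ell \<beta>}" "x \<in> desc \<beta> i \<and> y \<in> desc \<beta> i \<and> y \<le> x"
    then show ?thesis
      unfolding fence_le_def desc_def using length_eq by (intro bexI[of _ "2 * i"]) auto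
  qed
qed

lemma card_eq_sum_codes:
  assumes "X \<subseteq> fence \<beta>"
  shows "card X = (\<Sum>j=1..ell \<beta> + 1. acode \<beta> X j) + (\<Sum>i=1..ell \<beta>. dcode \<beta> X i)"
proof -
  have "card X = card (X \<inter> {..<peak \<beta> (ell \<beta> + 1)})"
    using assms by (simp add: fence_eq_lessThan Int_absorb2)
  also have "\<dots> = (\<Sum>j=1..ell \<beta> + 1. card (X \<inter> {past_valley \<beta> (j - 1)..<peak \<beta> j}))
      + (\<Sum>i=1..ell \<beta>. card (X \<inter> {peak \<beta> i..<past_valley \<beta> i}))"
    using past_valley_le_peak peak_less_past_valley
    by (intro card_Int_alternating_intervals) (auto simp: past_valley_0 less_imp_le)
  also have "\<dots> = (\<Sum>j=1..ell \<beta> + 1. acode \<beta> X j) + (\<Sum>i=1..ell \<beta>. dcode \<beta> X i)"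
    by (intro arg_cong2[where f = "(+)"] sum.cong refl)
      (simp_all add: acode_def dcode_def asc_unshared_eq desc_eq)
  finally show ?thesis .
qed

end

section \<open>Filters and ideals of the fence\<close>

definition filter_code :: "nat list \<Rightarrow> (nat \<Rightarrow> nat) \<Rightarrow> (nat \<Rightarrow> nat) \<Rightarrow> bool" where
  "filter_code \<beta> b e \<longleftrightarrow>
     (\<forall>j\<in>{1..ell \<beta> + 1}. b j \<le> cap \<beta> j) \<and>
     (\<forall>i\<in>{1..ell \<beta>}. e i \<le> delta \<beta> i + 1 \<and> (0 < b i \<longrightarrow> 0 < e i) \<and>
        (e i = delta \<beta> i + 1 \<longrightarrow> b (i + 1) = cap \<beta> (i + 1) \<and> (i < ell \<beta> \<longrightarrow> 0 < e (i + 1))))"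

definition ideal_code :: "nat list \<Rightarrow> (nat \<Rightarrow> nat) \<Rightarrow> (nat \<Rightarrow> nat) \<Rightarrow> bool" where
  "ideal_code \<beta> a d \<longleftrightarrow>
     (\<forall>j\<in>{1..ell \<beta> + 1}. a j \<le> cap \<beta> j) \<and>
     (\<forall>i\<in>{1..ell \<beta>}. d i \<le> delta \<beta> i + 1 \<and> (0 < a (i + 1) \<longrightarrow> 0 < d i) \<and>
        (d i = delta \<beta> i + 1 \<longrightarrow> a i = cap \<beta> i \<and> (1 < i \<longrightarrow> 0 < d (i - 1))))"

definition filter_set :: "nat list \<Rightarrow> (nat \<Rightarrow> nat) \<Rightarrow> (nat \<Rightarrow> nat) \<Rightarrow> nat set" where
  "filter_set \<beta> b e = {x \<in> fence \<beta>.
     (\<forall>j\<in>{1..ell \<beta> + 1}. x \<in> asc_unshared \<beta> j \<longrightarrow> peak \<beta> j \<le> x + b j) \<and>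
     (\<forall>i\<in>{1..ell \<beta>}. x \<in> desc \<beta> i \<longrightarrow> x < peak \<beta> i + e i)}"

lemma filter_set_cong:
  assumes "\<And>j. j \<in> {1..ell \<beta> + 1} \<Longrightarrow> b j = b' j" "\<And>i. i \<in> {1..ell \<beta>} \<Longrightarrow> e i = e' i"
  shows "filter_set \<beta> b e = filter_set \<beta> b' e'"
  using assms by (simp add: filter_set_def)

context odd_composition
begin

lemma asc_unshared_subset_asc: "asc_unshared \<beta> j \<subseteq> asc \<beta> j"
  by (auto simp: asc_unshared_def)

lemma asc_unshared_subset_fence: "j \<in> {1..ell \<beta> + 1} \<Longrightarrow> asc_unshared \<beta> j \<subseteq> fence \<beta>"
  using asc_eq[of j] asc_unshared_subset_asc by blast

lemma desc_subset_fence: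
  assumes "i \<in> {1..ell \<beta>}"
  shows "desc \<beta> i \<subseteq> fence \<beta>"
proof -
  have "2 * i \<in> {1..length \<beta>}" using assms length_eq by auto
  then show ?thesis unfolding desc_def fence_def by blast
qed

lemma fence_cases:
  assumes "x \<in> fence \<beta>"
  obtains (asc) j where "j \<in> {1..ell \<beta> + 1}" "x \<in> asc_unshared \<beta> j"
    | (desc) i where "i \<in> {1..ell \<beta>}" "x \<in> desc \<beta> i"
proof -
  have "(\<Sum>j=1..ell \<beta> + 1. acode \<beta> {x} j) + (\<Sum>i=1..ell \<beta>. dcode \<beta> {x} i) \<noteq> 0"
    using card_eq_sum_codes[of "{x}"] assms by simp
  then have "(\<exists>j\<in>{1..ell \<beta> + 1}. acode \<beta> {x} j \<noteq> 0) \<or> (\<exists>i\<in>{1..ell \<beta>}. dcode \<beta> {x} i \<noteq> 0)"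
    by (metis add_0 sum.neutral)
  then show thesis
    using asc desc by (auto simp: acode_def dcode_def)
qed

lemma asc_unshared_segment_unique:
  assumes "j \<in> {1..ell \<beta> + 1}" "x \<in> asc_unshared \<beta> j" "k \<in> {1..length \<beta>}" "x \<in> segment \<beta> k"
  shows "k = 2 * j - 1"
proof -
  have "2 * j - 1 \<in> {1..length \<beta>}" using assms(1) length_eq by auto
  then show ?thesis using assms unfolding asc_unshared_def asc_def shared_def by blast
qed

lemma filter_set_mem_asc_unshared:
  assumes "j \<in> {1..ell \<beta> + 1}" "x \<in> asc_unshared \<beta> j"
  shows "x \<in> filter_set \<beta> b e \<longleftrightarrow> peak \<beta> j \<le> x + b j"
proof -
  note unique = asc_unshared_segment_unique[OF assms]
  have "j' = j" if "j' \<in> {1..ell \<beta> + 1}" "x \<in> asc_unshared \<beta> j'" for j'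
  proof -
    have "2 * j' - 1 \<in> {1..length \<beta>}" using that(1) length_eq by auto
    then have "2 * j' - 1 = 2 * j - 1"
      using unique that(2) by (simp add: asc_unshared_def asc_def)
    then show ?thesis using that(1) assms(1) by auto
  qed
  moreover have "x \<notin> desc \<beta> i" if "i \<in> {1..ell \<beta>}" for i
    using unique[of "2 * i"] that assms(1) length_eq by (auto simp: desc_def) presburger
  ultimately show ?thesis
    using assms asc_unshared_subset_fence unfolding filter_set_def by blast
qed

lemma filter_set_mem_desc:
  assumes "i \<in> {1..ell \<beta>}" "x \<in> desc \<beta> i"
  shows "x \<in> filter_set \<beta> b e \<longleftrightarrow> x < peak \<beta> i + e i"
proof -
  have "x \<notin> asc_unshared \<beta> j" if "j \<in> {1..ell \<beta> + 1}" for j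
    using asc_unshared_segment_unique[of j x "2 * i"] that assms length_eq
    by (auto simp: desc_def) presburger
  moreover have "i' = i" if "i' \<in> {1..ell \<beta>}" "x \<in> desc \<beta> i'" for i'
    using segment_disjoint[OF pos, of "2 * i" "2 * i'"]
      segment_disjoint[OF pos, of "2 * i'" "2 * i"] that assms length_eq
    by (cases i i' rule: linorder_cases) (auto simp: desc_def)
  ultimately show ?thesis
    using assms desc_subset_fence unfolding filter_set_def by blast
qed

lemma fence_filters_iff:
  "U \<in> fence_filters \<beta> \<longleftrightarrow> U \<subseteq> fence \<beta> \<and>
    (\<forall>j\<in>{1..ell \<beta> + 1}. \<forall>x\<in>U \<inter> asc \<beta> j. \<forall>y\<in>asc \<beta> j. x \<le> y \<longrightarrow> y \<in> U) \<and>
    (\<forall>i\<in>{1..ell \<beta>}. \<forall>x\<in>U \<inter> desc \<beta> i. \<forall>y\<in>desc \<beta> i. y \<le> x \<longrightarrow> y \<in> U)"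
proof -
  have "asc \<beta> j \<subseteq> fence \<beta>" if "j \<in> {1..ell \<beta> + 1}" for j
    using asc_eq[OF that] by blast
  then show ?thesis
    using desc_subset_fence unfolding fence_filters_def fence_le_iff by blast
qed

lemma peak_mem:
  assumes "i \<in> {1..ell \<beta>}"
  shows "peak \<beta> i \<in> asc \<beta> i" "peak \<beta> i \<in> desc \<beta> i"
proof -
  show desc: "peak \<beta> i \<in> desc \<beta> i"
    using assms peak_less_past_valley[of i i] by (simp add: desc_eq)
  have "past_valley \<beta> (i - 1) \<le> peak \<beta> i" using assms past_valley_le_peak[of "i - 1" i] by auto
  then show "peak \<beta> i \<in> asc \<beta> i"
    using desc desc_subset_fence[OF assms] assms by (auto simp: asc_eq)
qed

lemma filter_mem_asc_unshared:
  assumes "U \<in> fence_filters \<beta>" "j \<in> {1..ell \<beta> + 1}" "x \<in> asc_unshared \<beta> j"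
  shows "x \<in> U \<longleftrightarrow> peak \<beta> j \<le> x + acode \<beta> U j"
proof -
  let ?X = "U \<inter> asc_unshared \<beta> j"
  have "y \<in> U" if "x \<in> U" "x \<in> asc_unshared \<beta> j" "y \<in> asc_unshared \<beta> j" "x \<le> y" for x y
    using assms(1,2) that unfolding fence_filters_iff asc_unshared_def by blast
  then have "?X = {peak \<beta> j - card ?X..<peak \<beta> j}"
    unfolding asc_unshared_eq[OF assms(2)] by (intro up_closed_eq_atLeastLessThan) auto
  then have "x \<in> ?X \<longleftrightarrow> x \<in> {peak \<beta> j - card ?X..<peak \<beta> j}" by blast
  then show ?thesis
    using assms(3) asc_unshared_eq[OF assms(2)] unfolding acode_def by auto
qed

lemma filter_mem_desc:
  assumes "U \<in> fence_filters \<beta>" "i \<in> {1..ell \<beta>}" "x \<in> desc \<beta> i"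
  shows "x \<in> U \<longleftrightarrow> x < peak \<beta> i + dcode \<beta> U i"
proof -
  let ?X = "U \<inter> desc \<beta> i"
  have "y \<in> U" if "x \<in> U" "x \<in> desc \<beta> i" "y \<in> desc \<beta> i" "y \<le> x" for x y
    using assms(1,2) that unfolding fence_filters_iff by blast
  then have "?X = {peak \<beta> i..<peak \<beta> i + card ?X}"
    unfolding desc_eq[OF assms(2)] by (intro down_closed_eq_atLeastLessThan) auto
  then have "x \<in> ?X \<longleftrightarrow> x \<in> {peak \<beta> i..<peak \<beta> i + card ?X}" by blast
  then show ?thesis
    using assms(3) desc_eq[OF assms(2)] unfolding dcode_def by auto
qed

lemma filter_eq_filter_set:
  assumes "U \<in> fence_filters \<beta>"
  shows "U = filter_set \<beta> (acode \<beta> U) (dcode \<beta> U)"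
proof (rule set_eqI)
  fix x
  have "U \<subseteq> fence \<beta>" using assms by (simp add: fence_filters_def)
  then consider (fence) "x \<in> fence \<beta>" | (outside) "x \<notin> U" "x \<notin> filter_set \<beta> (acode \<beta> U) (dcode \<beta> U)"
    unfolding filter_set_def by blast
  then show "x \<in> U \<longleftrightarrow> x \<in> filter_set \<beta> (acode \<beta> U) (dcode \<beta> U)"
  proof cases
    case fence
    then show ?thesis
      by (cases rule: fence_cases)
        (simp_all add: filter_mem_asc_unshared[OF assms] filter_mem_desc[OF assms]
          filter_set_mem_asc_unshared filter_set_mem_desc)
  qed simp
qed

lemma filter_asc_up_closed:
  assumes "U \<in> fence_filters \<beta>" "j \<in> {1..ell \<beta> + 1}"
    and "x \<in> U" "x \<in> asc \<beta> j" "y \<in> asc \<beta> j" "x \<le> y"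
  shows "y \<in> U"
  using assms unfolding fence_filters_iff by blast

lemma peak_mem_filter_iff:
  assumes "U \<in> fence_filters \<beta>" "i \<in> {1..ell \<beta>}"
  shows "peak \<beta> i \<in> U \<longleftrightarrow> 0 < dcode \<beta> U i"
  using filter_mem_desc[OF assms peak_mem(2)[OF assms(2)]] by simp

lemma dcode_filter_pos:
  assumes U: "U \<in> fence_filters \<beta>" and i: "i \<in> {1..ell \<beta>}" and "0 < acode \<beta> U i"
  shows "0 < dcode \<beta> U i"
proof -
  have i': "i \<in> {1..ell \<beta> + 1}" using i by simp
  obtain x where "x \<in> U" "x \<in> asc_unshared \<beta> i"
    using assms(3) unfolding acode_def by (auto simp: card_gt_0_iff)
  moreover from this have "x \<in> asc \<beta> i" "x \<le> peak \<beta> i"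
    using asc_eq[OF i'] by (auto simp: asc_unshared_def)
  ultimately have "peak \<beta> i \<in> U"
    using filter_asc_up_closed[OF U i'] peak_mem(1)[OF i] by blast
  then show ?thesis using peak_mem_filter_iff[OF U i] by blast
qed

lemma filter_contains_desc:
  assumes U: "U \<in> fence_filters \<beta>" and i: "i \<in> {1..ell \<beta>}" and full: "dcode \<beta> U i = delta \<beta> i + 1"
  shows "acode \<beta> U (i + 1) = cap \<beta> (i + 1)" and "i < ell \<beta> \<Longrightarrow> 0 < dcode \<beta> U (i + 1)"
proof -
  have i': "i + 1 \<in> {1..ell \<beta> + 1}" using i by simp
  define v where "v = past_valley \<beta> i - 1"
  have bounds: "peak \<beta> i < past_valley \<beta> i" "past_valley \<beta> i \<le> peak \<beta> (i + 1)"
    using i peak_less_past_valley[of i i] past_valley_le_peak[of i "i + 1"] by auto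
  then have v: "v \<in> desc \<beta> i" "Suc v = past_valley \<beta> i" using i by (auto simp: v_def desc_eq)
  then have "v \<in> U"
    using filter_mem_desc[OF U i v(1)] bounds delta_eq_diff[OF i] full by simp
  moreover have "v \<in> asc \<beta> (i + 1)"
    using v bounds desc_subset_fence[OF i] asc_eq[OF i'] by auto
  ultimately have above: "y \<in> U" if "y \<in> asc \<beta> (i + 1)" "v \<le> y" for y
    using filter_asc_up_closed[OF U i'] that by blast
  have "v \<le> y" if "y \<in> asc_unshared \<beta> (i + 1)" for y
    using that asc_unshared_eq[OF i'] v(2) by auto
  then have "asc_unshared \<beta> (i + 1) \<subseteq> U"
    using above asc_unshared_subset_asc by blast
  then show "acode \<beta> U (i + 1) = cap \<beta> (i + 1)"
    by (simp add: acode_def cap_def Int_absorb1)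
  show "0 < dcode \<beta> U (i + 1)" if "i < ell \<beta>"
  proof -
    have succ: "i + 1 \<in> {1..ell \<beta>}" using that by simp
    then have "peak \<beta> (i + 1) \<in> U" using above peak_mem(1) bounds(2) v(2) by simp
    then show ?thesis using peak_mem_filter_iff[OF U succ] by blast
  qed
qed

lemma filter_code_of_filter:
  assumes U: "U \<in> fence_filters \<beta>"
  shows "filter_code \<beta> (acode \<beta> U) (dcode \<beta> U)"
proof -
  have "acode \<beta> U j \<le> cap \<beta> j" if "j \<in> {1..ell \<beta> + 1}" for j
    unfolding cap_eq_diff[OF that] acode_def asc_unshared_eq[OF that]
    by (metis Int_lower2 card_atLeastLessThan card_mono finite_atLeastLessThan)
  moreover have "dcode \<beta> U i \<le> delta \<beta> i + 1" if "i \<in> {1..ell \<beta>}" for i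
    unfolding delta_eq_diff[OF that] dcode_def desc_eq[OF that]
    by (metis Int_lower2 card_atLeastLessThan card_mono finite_atLeastLessThan)
  ultimately show ?thesis
    unfolding filter_code_def using dcode_filter_pos[OF U] filter_contains_desc[OF U] by blast
qed

lemma filter_set_asc_below_peak:
  assumes code: "filter_code \<beta> b e" and j: "j \<in> {1..ell \<beta> + 1}"
    and x: "x \<in> filter_set \<beta> b e" "x \<in> asc \<beta> j" "x < peak \<beta> j"
  shows "peak \<beta> j \<le> Suc x + b j" and "j \<le> ell \<beta> \<Longrightarrow> 0 < e j"
proof -
  have "peak \<beta> j \<le> Suc x + b j \<and> (j \<le> ell \<beta> \<longrightarrow> 0 < e j)"
  proof (cases "past_valley \<beta> (j - 1) \<le> x")
    case True
    then have "peak \<beta> j \<le> x + b j"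
      using x filter_set_mem_asc_unshared[OF j] asc_unshared_eq[OF j] by auto
    moreover have "0 < e j" if "0 < b j" "j \<le> ell \<beta>"
      using code j that unfolding filter_code_def by auto
    ultimately show ?thesis using x(3) by auto
  next
    case False
    define i where "i = j - 1"
    have past_valley: "past_valley \<beta> i = Suc x"
      using False x(2) asc_eq[OF j] by (simp add: i_def)
    then have i: "i \<in> {1..ell \<beta>}" "j = i + 1"
      using j past_valley_0 by (cases "i = 0"; auto simp: i_def)+
    have "x \<in> desc \<beta> i"
      using past_valley i peak_less_past_valley[of i i] desc_eq by auto
    then have "x < peak \<beta> i + e i" using x(1) filter_set_mem_desc[OF i(1)] by blast
    moreover have "e i \<le> delta \<beta> i + 1"
      "e i = delta \<beta> i + 1 \<longrightarrow> b j = cap \<beta> j \<and> (j \<le> ell \<beta> \<longrightarrow> 0 < e j)"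
      using code i unfolding filter_code_def by auto
    ultimately show ?thesis
      using delta_eq_diff[OF i(1)] cap_eq_diff[OF j] past_valley i(2) by auto
  qed
  then show "peak \<beta> j \<le> Suc x + b j" and "j \<le> ell \<beta> \<Longrightarrow> 0 < e j" by blast+
qed

lemma filter_set_in_fence_filters:
  assumes code: "filter_code \<beta> b e"
  shows "filter_set \<beta> b e \<in> fence_filters \<beta>"
  unfolding fence_filters_iff
proof (intro conjI ballI impI)
  let ?U = "filter_set \<beta> b e"
  show "?U \<subseteq> fence \<beta>" by (auto simp: filter_set_def)
  show "y \<in> ?U" if "i \<in> {1..ell \<beta>}" "x \<in> ?U \<inter> desc \<beta> i" "y \<in> desc \<beta> i" "y \<le> x" for i x y
    using that by (auto simp: filter_set_mem_desc)
  fix j x y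
  assume j: "j \<in> {1..ell \<beta> + 1}" and x: "x \<in> ?U \<inter> asc \<beta> j" and y: "y \<in> asc \<beta> j" "x \<le> y"
  show "y \<in> ?U"
  proof (cases "x = y")
    case False
    then have x_less: "x < y" "x < peak \<beta> j" using y asc_eq[OF j] by auto
    have above: "peak \<beta> j \<le> Suc x + b j" "j \<le> ell \<beta> \<Longrightarrow> 0 < e j"
      using filter_set_asc_below_peak[OF code j] x x_less(2) by blast+
    show ?thesis
    proof (cases "y = peak \<beta> j")
      case True
      then have "j \<in> {1..ell \<beta>}"
        using y(1) j asc_eq[OF j] fence_eq_lessThan by (cases "j = ell \<beta> + 1") auto
      then show ?thesis
        using True above(2) peak_mem(2) filter_set_mem_desc by simp
    next
      case False
      then have "y \<in> asc_unshared \<beta> j"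
        using x y(1) x_less(1) asc_eq[OF j] asc_unshared_eq[OF j] by auto
      then show ?thesis
        using above(1) x_less(1) filter_set_mem_asc_unshared[OF j] by simp
    qed
  qed (use x in simp)
qed

lemma encodes_filter_set:
  assumes "filter_code \<beta> b e"
  shows "encodes \<beta> (filter_set \<beta> b e) (b, e)"
proof -
  have "acode \<beta> (filter_set \<beta> b e) j = b j" if j: "j \<in> {1..ell \<beta> + 1}" for j
  proof -
    have "b j \<le> peak \<beta> j - past_valley \<beta> (j - 1)"
      using assms j unfolding cap_eq_diff[OF j, symmetric] filter_code_def by blast
    moreover have "past_valley \<beta> (j - 1) \<le> peak \<beta> j" using j by (intro past_valley_le_peak) auto
    ultimately have "filter_set \<beta> b e \<inter> asc_unshared \<beta> j = {peak \<beta> j - b j..<peak \<beta> j}"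
      using filter_set_mem_asc_unshared[OF j] by (auto simp: asc_unshared_eq[OF j])
    then show ?thesis
      using \<open>b j \<le> _\<close> by (simp add: acode_def)
  qed
  moreover have "dcode \<beta> (filter_set \<beta> b e) i = e i" if i: "i \<in> {1..ell \<beta>}" for i
  proof -
    have "e i \<le> past_valley \<beta> i - peak \<beta> i"
      using assms i unfolding delta_eq_diff[OF i, symmetric] filter_code_def by blast
    then have "filter_set \<beta> b e \<inter> desc \<beta> i = {peak \<beta> i..<peak \<beta> i + e i}"
      using filter_set_mem_desc[OF i] by (auto simp: desc_eq[OF i])
    then show ?thesis by (simp add: dcode_def)
  qed
  ultimately show ?thesis by (simp add: encodes_def)
qed

lemma fence_ideals_iff_filters:
  "I \<subseteq> fence \<beta> \<Longrightarrow> I \<in> fence_ideals \<beta> \<longleftrightarrow> fence \<beta> - I \<in> fence_filters \<beta>"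
  unfolding fence_ideals_def fence_filters_def by blast

lemma code_complement:
  shows "j \<in> {1..ell \<beta> + 1} \<Longrightarrow> acode \<beta> (fence \<beta> - X) j + acode \<beta> X j = cap \<beta> j"
    and "i \<in> {1..ell \<beta>} \<Longrightarrow> dcode \<beta> (fence \<beta> - X) i + dcode \<beta> X i = delta \<beta> i + 1"
proof -
  have compl: "card ((fence \<beta> - X) \<inter> S) + card (X \<inter> S) = card S" if "S \<subseteq> fence \<beta>" "finite S" for S
  proof -
    have "(fence \<beta> - X) \<inter> S = S - X" using that by blast
    then show ?thesis using card_Int_Diff[OF that(2), of X] by (simp add: Int_commute)
  qed
  show "acode \<beta> (fence \<beta> - X) j + acode \<beta> X j = cap \<beta> j" if "j \<in> {1..ell \<beta> + 1}"
    using compl[OF asc_unshared_subset_fence[OF that]] asc_unshared_eq[OF that] cap_eq_diff[OF that]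
    by (simp add: acode_def)
  show "dcode \<beta> (fence \<beta> - X) i + dcode \<beta> X i = delta \<beta> i + 1" if "i \<in> {1..ell \<beta>}"
    using compl[OF desc_subset_fence[OF that]] desc_eq[OF that] delta_eq_diff[OF that]
    by (simp add: dcode_def)
qed

lemma filter_code_complement:
  assumes "ideal_code \<beta> a d"
    and b_compl: "\<And>j. j \<in> {1..ell \<beta> + 1} \<Longrightarrow> b j + a j = cap \<beta> j"
    and e_compl: "\<And>i. i \<in> {1..ell \<beta>} \<Longrightarrow> e i + d i = delta \<beta> i + 1"
  shows "filter_code \<beta> b e"
proof -
  have code: "0 < a (i + 1) \<Longrightarrow> 0 < d i" "d i = delta \<beta> i + 1 \<Longrightarrow> a i = cap \<beta> i"
      "d i = delta \<beta> i + 1 \<Longrightarrow> 1 < i \<Longrightarrow> 0 < d (i - 1)" if "i \<in> {1..ell \<beta>}" for i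
    using assms(1) that unfolding ideal_code_def by blast+
  have "b j \<le> cap \<beta> j" if "j \<in> {1..ell \<beta> + 1}" for j
    using b_compl[OF that] by linarith
  moreover have "e i \<le> delta \<beta> i + 1" if "i \<in> {1..ell \<beta>}" for i
    using e_compl[OF that] by linarith
  moreover have "0 < e i" if "i \<in> {1..ell \<beta>}" "0 < b i" for i
    using code(2)[OF that(1)] e_compl[OF that(1)] b_compl[of i] that by force
  moreover have "b (i + 1) = cap \<beta> (i + 1)" if "i \<in> {1..ell \<beta>}" "e i = delta \<beta> i + 1" for i
    using code(1)[OF that(1)] e_compl[OF that(1)] b_compl[of "i + 1"] that by force
  moreover have "0 < e (i + 1)" if "i \<in> {1..ell \<beta>}" "e i = delta \<beta> i + 1" "i < ell \<beta>" for i
    using code(3)[of "i + 1"] e_compl[OF that(1)] e_compl[of "i + 1"] that by force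
  ultimately show ?thesis unfolding filter_code_def by blast
qed

lemma ideal_code_complement:
  assumes "filter_code \<beta> b e"
    and b_compl: "\<And>j. j \<in> {1..ell \<beta> + 1} \<Longrightarrow> b j + a j = cap \<beta> j"
    and e_compl: "\<And>i. i \<in> {1..ell \<beta>} \<Longrightarrow> e i + d i = delta \<beta> i + 1"
  shows "ideal_code \<beta> a d"
proof -
  have code: "0 < b i \<Longrightarrow> 0 < e i" "e i = delta \<beta> i + 1 \<Longrightarrow> b (i + 1) = cap \<beta> (i + 1)"
      "e i = delta \<beta> i + 1 \<Longrightarrow> i < ell \<beta> \<Longrightarrow> 0 < e (i + 1)" if "i \<in> {1..ell \<beta>}" for i
    using assms(1) that unfolding filter_code_def by blast+
  have "a j \<le> cap \<beta> j" if "j \<in> {1..ell \<beta> + 1}" for j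
    using b_compl[OF that] by linarith
  moreover have "d i \<le> delta \<beta> i + 1" if "i \<in> {1..ell \<beta>}" for i
    using e_compl[OF that] by linarith
  moreover have "0 < d i" if "i \<in> {1..ell \<beta>}" "0 < a (i + 1)" for i
    using code(2)[OF that(1)] e_compl[OF that(1)] b_compl[of "i + 1"] that by force
  moreover have "a i = cap \<beta> i" if "i \<in> {1..ell \<beta>}" "d i = delta \<beta> i + 1" for i
    using code(1)[OF that(1)] e_compl[OF that(1)] b_compl[of i] that by force
  moreover have "0 < d (i - 1)" if i: "i \<in> {1..ell \<beta>}" "d i = delta \<beta> i + 1" "1 < i" for i
  proof -
    have prev: "i - 1 \<in> {1..ell \<beta>}" "i - 1 < ell \<beta>" "i - 1 + 1 = i" using i by auto
    then show ?thesis using code(3)[OF prev(1)] e_compl[OF prev(1)] e_compl[OF i(1)] i(2) by force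
  qed
  ultimately show ?thesis unfolding ideal_code_def by blast
qed

lemma ideal_code_of_ideal:
  assumes "I \<in> fence_ideals \<beta>"
  shows "ideal_code \<beta> (acode \<beta> I) (dcode \<beta> I)"
proof -
  have "I \<subseteq> fence \<beta>" using assms by (simp add: fence_ideals_def)
  then have "fence \<beta> - I \<in> fence_filters \<beta>" using assms fence_ideals_iff_filters by blast
  then show ?thesis
    using ideal_code_complement[OF filter_code_of_filter code_complement] by blast
qed

lemma ex_ideal_encodes:
  assumes "ideal_code \<beta> a d"
  obtains I where "I \<in> fence_ideals \<beta>" "encodes \<beta> I (a, d)"
proof -
  define b e where "b j = cap \<beta> j - a j" and "e i = delta \<beta> i + 1 - d i" for i j
  define U where "U = filter_set \<beta> b e"
  have b_compl: "b j + a j = cap \<beta> j" if "j \<in> {1..ell \<beta> + 1}" for j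
    using assms that unfolding ideal_code_def b_def by (intro le_add_diff_inverse2) blast
  have e_compl: "e i + d i = delta \<beta> i + 1" if "i \<in> {1..ell \<beta>}" for i
    using assms that unfolding ideal_code_def e_def by (intro le_add_diff_inverse2) blast
  have "filter_code \<beta> b e" by (rule filter_code_complement[OF assms b_compl e_compl])
  then have U: "U \<in> fence_filters \<beta>" "encodes \<beta> U (b, e)"
    unfolding U_def by (rule filter_set_in_fence_filters, rule encodes_filter_set)
  have "fence \<beta> - (fence \<beta> - U) = U" using U(1) by (auto simp: fence_filters_def)
  then have "fence \<beta> - U \<in> fence_ideals \<beta>"
    using U(1) fence_ideals_iff_filters[of "fence \<beta> - U"] by simp
  moreover have "acode \<beta> (fence \<beta> - U) j = a j" if "j \<in> {1..ell \<beta> + 1}" for j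
    using U(2) that b_compl[OF that] code_complement(1)[OF that, of U] by (simp add: encodes_def)
  moreover have "dcode \<beta> (fence \<beta> - U) i = d i" if "i \<in> {1..ell \<beta>}" for i
    using U(2) that e_compl[OF that] code_complement(2)[OF that, of U] by (simp add: encodes_def)
  ultimately show thesis by (intro that) (auto simp: encodes_def)
qed

lemma filter_eqI:
  assumes "U \<in> fence_filters \<beta>" "V \<in> fence_filters \<beta>" "encodes \<beta> U (acode \<beta> V, dcode \<beta> V)"
  shows "U = V"
proof -
  have "filter_set \<beta> (acode \<beta> U) (dcode \<beta> U) = filter_set \<beta> (acode \<beta> V) (dcode \<beta> V)"
    using assms(3) by (intro filter_set_cong) (simp_all add: encodes_def)
  then show ?thesis
    using filter_eq_filter_set[OF assms(1)] filter_eq_filter_set[OF assms(2)] by simp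
qed

lemma ideal_eqI:
  assumes I: "I \<in> fence_ideals \<beta>" and J: "J \<in> fence_ideals \<beta>"
    and code: "encodes \<beta> I (acode \<beta> J, dcode \<beta> J)"
  shows "I = J"
proof -
  have sub: "I \<subseteq> fence \<beta>" "J \<subseteq> fence \<beta>" using I J by (auto simp: fence_ideals_def)
  have "acode \<beta> (fence \<beta> - I) j = acode \<beta> (fence \<beta> - J) j" if "j \<in> {1..ell \<beta> + 1}" for j
    using code that code_complement(1)[OF that, of I] code_complement(1)[OF that, of J]
    by (simp add: encodes_def)
  moreover have "dcode \<beta> (fence \<beta> - I) i = dcode \<beta> (fence \<beta> - J) i" if "i \<in> {1..ell \<beta>}" for i
    using code that code_complement(2)[OF that, of I] code_complement(2)[OF that, of J]
    by (simp add: encodes_def)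
  ultimately have "fence \<beta> - I = fence \<beta> - J"
    using I J sub fence_ideals_iff_filters by (intro filter_eqI) (auto simp: encodes_def)
  then show ?thesis using sub by blast
qed

end

section \<open>The three steps on encodings\<close>

definition cut_at :: "nat list \<Rightarrow> (nat \<Rightarrow> nat) \<Rightarrow> nat \<Rightarrow> bool" where
  "cut_at \<beta> a j \<longleftrightarrow> j = 1 \<or> j = ell \<beta> + 1 \<or> a j < cap \<beta> j"

definition restricted_ideal_code :: "nat list \<Rightarrow> (nat \<Rightarrow> nat) \<Rightarrow> (nat \<Rightarrow> nat) \<Rightarrow> bool" where
  "restricted_ideal_code \<beta> a d \<longleftrightarrow> ideal_code \<beta> a d \<and>
     (1 \<le> ell \<beta> \<longrightarrow> d 1 \<le> delta \<beta> 1 \<and> (d (ell \<beta>) \<noteq> 1 \<or> a (ell \<beta> + 1) < cap \<beta> (ell \<beta> + 1)))"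

definition restricted_filter_code :: "nat list \<Rightarrow> (nat \<Rightarrow> nat) \<Rightarrow> (nat \<Rightarrow> nat) \<Rightarrow> bool" where
  "restricted_filter_code \<beta> b e \<longleftrightarrow> filter_code \<beta> b e \<and>
     (1 \<le> ell \<beta> \<longrightarrow> e (ell \<beta>) \<le> delta \<beta> (ell \<beta>) \<and> (e 1 \<noteq> 1 \<or> b 1 < cap \<beta> 1))"

text \<open>
  Invariants between \<open>PH1\<close> and \<open>PH2\<close> and between \<open>PH2\<close> and \<open>PH3\<close>: no factor ends in \<open>1\<close>,
  respectively starts with \<open>1\<close>.
\<close>

definition reduced_ideal_code :: "nat list \<Rightarrow> (nat \<Rightarrow> nat) \<Rightarrow> (nat \<Rightarrow> nat) \<Rightarrow> bool" where
  "reduced_ideal_code \<beta> a d \<longleftrightarrow>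
     (\<forall>j\<in>{1..ell \<beta> + 1}. a j \<le> cap \<beta> j) \<and>
     (\<forall>i\<in>{1..ell \<beta>}. d i \<le> delta \<beta> i + 1 \<and> (d i = 1 \<longrightarrow> \<not> cut_at \<beta> a (i + 1)) \<and>
        (d i = delta \<beta> i + 1 \<longrightarrow> \<not> cut_at \<beta> a i \<and> 0 < d (i - 1)))"

definition reduced_filter_code :: "nat list \<Rightarrow> (nat \<Rightarrow> nat) \<Rightarrow> (nat \<Rightarrow> nat) \<Rightarrow> bool" where
  "reduced_filter_code \<beta> b e \<longleftrightarrow>
     (\<forall>j\<in>{1..ell \<beta> + 1}. b j \<le> cap \<beta> j) \<and>
     (\<forall>i\<in>{1..ell \<beta>}. e i \<le> delta \<beta> i + 1 \<and> (e i = 1 \<longrightarrow> \<not> cut_at \<beta> b i) \<and>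
        (e i = delta \<beta> i + 1 \<longrightarrow> \<not> cut_at \<beta> b (i + 1) \<and> 0 < e (i + 1)))"

text \<open>
  \<open>PH3\<close> applies \<open>absorb\<close> to the pairs \<open>(b\<^sub>i, e\<^sub>i)\<close>, and \<open>PH1\<close> undoes it on the pairs
  \<open>(a\<^bsub>i+1\<^esub>, d\<^sub>i)\<close>.
\<close>

definition absorb :: "nat \<times> nat \<Rightarrow> nat \<times> nat" where
  "absorb = (\<lambda>(a, d). if d = 0 \<and> 0 < a then (a - 1, 1) else (a, d))"

definition absorbed_left ::
    "nat list \<Rightarrow> (nat \<Rightarrow> nat) \<Rightarrow> (nat \<Rightarrow> nat) \<Rightarrow> (nat \<Rightarrow> nat) \<Rightarrow> (nat \<Rightarrow> nat) \<Rightarrow> bool" where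
  "absorbed_left \<beta> a' d' a d \<longleftrightarrow> a 1 = a' 1 \<and>
     (\<forall>i\<in>{1..ell \<beta>}. (a (i + 1), d i) = absorb (a' (i + 1), d' i))"

definition absorbed_right ::
    "nat list \<Rightarrow> (nat \<Rightarrow> nat) \<Rightarrow> (nat \<Rightarrow> nat) \<Rightarrow> (nat \<Rightarrow> nat) \<Rightarrow> (nat \<Rightarrow> nat) \<Rightarrow> bool" where
  "absorbed_right \<beta> b' e' b e \<longleftrightarrow> b (ell \<beta> + 1) = b' (ell \<beta> + 1) \<and>
     (\<forall>i\<in>{1..ell \<beta>}. (b i, e i) = absorb (b' i, e' i))"

definition Phi_graph ::
    "nat list \<Rightarrow> (nat \<Rightarrow> nat) \<Rightarrow> (nat \<Rightarrow> nat) \<Rightarrow> (nat \<Rightarrow> nat) \<Rightarrow> (nat \<Rightarrow> nat) \<Rightarrow> bool" where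
  "Phi_graph \<beta> a d b e \<longleftrightarrow> (\<exists>c t u v.
     (\<forall>j\<in>{1..ell \<beta> + 1}. c j \<le> cap \<beta> j) \<and> phi_graph (ell \<beta>) (cut_at \<beta> c) t u v \<and>
     absorbed_left \<beta> c u a d \<and> absorbed_right \<beta> c v b e)"

lemma absorb_sum: "absorb (a, d) = (a', d') \<Longrightarrow> a' + d' = a + d"
  by (auto simp: absorb_def split: if_splits)

lemma absorb_inj:
  assumes "absorb (a, d) = absorb (a', d')" "a \<le> k" "a' \<le> k"
    and "d = 1 \<Longrightarrow> a = k" "d' = 1 \<Longrightarrow> a' = k"
  shows "a = a' \<and> d = d'"
  using assms by (auto simp: absorb_def split: if_splits)

lemma sum_absorbed_left:
  assumes "absorbed_left \<beta> a' d' a d"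
  shows "sum a {1..ell \<beta> + 1} + sum d {1..ell \<beta>} = sum a' {1..ell \<beta> + 1} + sum d' {1..ell \<beta>}"
proof -
  have shift: "sum f {1..ell \<beta> + 1} = f 1 + (\<Sum>i=1..ell \<beta>. f (i + 1))" for f :: "nat \<Rightarrow> nat"
    by (simp add: sum.atLeast_Suc_atMost sum.shift_bounds_cl_Suc_ivl del: sum.cl_ivl_Suc)
  have "a 1 = a' 1" "\<forall>i\<in>{1..ell \<beta>}. a (i + 1) + d i = a' (i + 1) + d' i"
    using assms absorb_sum unfolding absorbed_left_def by metis+
  then show ?thesis
    unfolding shift by (simp add: add.assoc flip: sum.distrib)
qed

lemma sum_absorbed_right:
  assumes "absorbed_right \<beta> b' e' b e"
  shows "sum b {1..ell \<beta> + 1} + sum e {1..ell \<beta>} = sum b' {1..ell \<beta> + 1} + sum e' {1..ell \<beta>}"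
proof -
  have "\<forall>i\<in>{1..ell \<beta>}. b i + e i = b' i + e' i"
    using assms absorb_sum unfolding absorbed_right_def by metis
  then have "(\<Sum>i=1..ell \<beta>. b i + e i) = (\<Sum>i=1..ell \<beta>. b' i + e' i)" by simp
  then show ?thesis
    using assms by (simp add: absorbed_right_def sum.distrib)
qed

lemma sum_Phi_graph:
  assumes "Phi_graph \<beta> a d b e"
  shows "sum b {1..ell \<beta> + 1} + sum e {1..ell \<beta>} = sum a {1..ell \<beta> + 1} + sum d {1..ell \<beta>}"
proof -
  obtain c t u v where "phi_graph (ell \<beta>) (cut_at \<beta> c) t u v"
    "absorbed_left \<beta> c u a d" "absorbed_right \<beta> c v b e"
    using assms unfolding Phi_graph_def by blast
  then show ?thesis
    using sum_absorbed_left[of \<beta> c u a d] sum_absorbed_right[of \<beta> c v b e] sum_phi_graph by simp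
qed

lemma encodes_codes: "encodes \<beta> X (acode \<beta> X, dcode \<beta> X)"
  by (simp add: encodes_def)

lemma Phi_graph_encodes:
  assumes "Phi_graph \<beta> a d b e" "encodes \<beta> I (a, d)" "encodes \<beta> U (b, e)"
  shows "Phi_graph \<beta> (acode \<beta> I) (dcode \<beta> I) (acode \<beta> U) (dcode \<beta> U)"
proof -
  have "absorbed_left \<beta> c u a d \<Longrightarrow> absorbed_left \<beta> c u (acode \<beta> I) (dcode \<beta> I)" for c u
    using assms(2) by (simp add: absorbed_left_def encodes_def)
  moreover have "absorbed_right \<beta> c v b e \<Longrightarrow> absorbed_right \<beta> c v (acode \<beta> U) (dcode \<beta> U)" for c v
    using assms(3) by (simp add: absorbed_right_def encodes_def)
  ultimately show ?thesis using assms(1) unfolding Phi_graph_def by blast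
qed

lemma absorbed_left_inj:
  assumes "absorbed_left \<beta> c u a d" "absorbed_left \<beta> c' u' a d"
    and "\<forall>j\<in>{1..ell \<beta> + 1}. c j \<le> cap \<beta> j" "\<forall>j\<in>{1..ell \<beta> + 1}. c' j \<le> cap \<beta> j"
    and "\<forall>i\<in>{1..ell \<beta>}. u i = 1 \<longrightarrow> \<not> cut_at \<beta> c (i + 1)"
    and "\<forall>i\<in>{1..ell \<beta>}. u' i = 1 \<longrightarrow> \<not> cut_at \<beta> c' (i + 1)"
  shows "j \<in> {1..ell \<beta> + 1} \<Longrightarrow> c j = c' j" and "i \<in> {1..ell \<beta>} \<Longrightarrow> u i = u' i"
proof -
  have pair_eq: "c (i + 1) = c' (i + 1) \<and> u i = u' i" if i: "i \<in> {1..ell \<beta>}" for i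
  proof (rule absorb_inj)
    show "absorb (c (i + 1), u i) = absorb (c' (i + 1), u' i)"
      using assms(1,2) i unfolding absorbed_left_def by metis
    show "c (i + 1) \<le> cap \<beta> (i + 1)" "c' (i + 1) \<le> cap \<beta> (i + 1)" using assms(3,4) i by auto
    then show "u i = 1 \<Longrightarrow> c (i + 1) = cap \<beta> (i + 1)" "u' i = 1 \<Longrightarrow> c' (i + 1) = cap \<beta> (i + 1)"
      using assms(5,6) i by (auto simp: cut_at_def)
  qed
  then show "i \<in> {1..ell \<beta>} \<Longrightarrow> u i = u' i" by blast
  show "c j = c' j" if "j \<in> {1..ell \<beta> + 1}"
  proof (cases "j = 1")
    case True
    then show ?thesis using assms(1,2) by (simp add: absorbed_left_def)
  next
    case False
    then have "j - 1 \<in> {1..ell \<beta>}" "j - 1 + 1 = j" using that by auto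
    then show ?thesis using pair_eq[of "j - 1"] by simp
  qed
qed

lemma Phi_graph_functional:
  assumes "Phi_graph \<beta> a d b e" "Phi_graph \<beta> a d b' e'"
  shows "j \<in> {1..ell \<beta> + 1} \<Longrightarrow> b j = b' j" and "i \<in> {1..ell \<beta>} \<Longrightarrow> e i = e' i"
proof -
  obtain c t u v where c_le: "\<forall>j\<in>{1..ell \<beta> + 1}. c j \<le> cap \<beta> j"
    and graph: "phi_graph (ell \<beta>) (cut_at \<beta> c) t u v"
    and left: "absorbed_left \<beta> c u a d" and right: "absorbed_right \<beta> c v b e"
    using assms(1) unfolding Phi_graph_def by blast
  obtain c' t' u' v' where c'_le: "\<forall>j\<in>{1..ell \<beta> + 1}. c' j \<le> cap \<beta> j"
    and graph': "phi_graph (ell \<beta>) (cut_at \<beta> c') t' u' v'"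
    and left': "absorbed_left \<beta> c' u' a d" and right': "absorbed_right \<beta> c' v' b' e'"
    using assms(2) unfolding Phi_graph_def by blast
  have no_one: "\<forall>i\<in>{1..ell \<beta>}. u i = 1 \<longrightarrow> \<not> cut_at \<beta> c (i + 1)"
    "\<forall>i\<in>{1..ell \<beta>}. u' i = 1 \<longrightarrow> \<not> cut_at \<beta> c' (i + 1)"
    using phi_graph_one_before_cut[OF graph] phi_graph_one_before_cut[OF graph'] by blast+
  note c_eq = absorbed_left_inj(1)[OF left left' c_le c'_le no_one]
    and u_eq = absorbed_left_inj(2)[OF left left' c_le c'_le no_one]
  have v_eq: "v i = v' i" if "i \<in> {1..ell \<beta>}" for i
    using phi_graph_functional[OF graph graph' _ u_eq that] c_eq by (simp add: cut_at_def)
  have pair_eq: "b i = b' i \<and> e i = e' i" if "i \<in> {1..ell \<beta>}" for i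
    using right right' c_eq[of i] v_eq[OF that] that unfolding absorbed_right_def
    by (metis Pair_inject atLeastAtMost_iff trans_le_add1)
  then show "i \<in> {1..ell \<beta>} \<Longrightarrow> e i = e' i" by blast
  show "b j = b' j" if "j \<in> {1..ell \<beta> + 1}"
  proof (cases "j = ell \<beta> + 1")
    case True
    then show ?thesis using right right' c_eq[of j] that by (simp add: absorbed_right_def)
  next
    case False
    then show ?thesis using pair_eq[of j] that by simp
  qed
qed

context odd_composition
begin

lemma delta_pos: "i \<in> {1..ell \<beta>} \<Longrightarrow> 0 < delta \<beta> i"
  using pos length_eq by (auto simp: delta_def)

lemma mirrored_cut_at:
  "mirrored (ell \<beta> + 1) (cut_at \<beta> c) (cut_at (rev \<beta>) (mirror (ell \<beta> + 1) c))"
  unfolding mirrored_def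
proof
  fix j assume j: "j \<in> {1..ell \<beta> + 1}"
  then have "ell \<beta> + 2 - j = 1 \<longleftrightarrow> j = ell \<beta> + 1" "ell \<beta> + 2 - j = ell \<beta> + 1 \<longleftrightarrow> j = 1"
    by auto
  then show "cut_at (rev \<beta>) (mirror (ell \<beta> + 1) c) j = mirror (ell \<beta> + 1) (cut_at \<beta> c) j"
    using cap_rev[OF j] by (auto simp: cut_at_def ell_rev mirror_def)
qed

lemma absorbed_left_mirror:
  assumes "absorbed_right \<beta> c v b e" "mirrored (ell \<beta> + 1) b b'" "mirrored (ell \<beta>) e e'"
  shows "absorbed_left (rev \<beta>) (mirror (ell \<beta> + 1) c) (mirror (ell \<beta>) v) b' e'"
  unfolding absorbed_left_def ell_rev
proof (intro conjI ballI)
  show "b' 1 = mirror (ell \<beta> + 1) c 1"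
    using assms(1) mirroredD[OF assms(2), of 1] by (simp add: absorbed_right_def mirror_def)
next
  fix i assume i: "i \<in> {1..ell \<beta>}"
  then have "ell \<beta> + 1 - i \<in> {1..ell \<beta>}" by auto
  moreover have "b' (i + 1) = b (ell \<beta> + 1 - i)" "e' i = e (ell \<beta> + 1 - i)"
    using mirroredD[OF assms(2), of "i + 1"] mirroredD[OF assms(3) i] i by auto
  ultimately show
    "(b' (i + 1), e' i) = absorb (mirror (ell \<beta> + 1) c (i + 1), mirror (ell \<beta>) v i)"
    using assms(1) by (simp add: absorbed_right_def mirror_def)
qed

lemma absorbed_right_mirror:
  assumes "absorbed_left \<beta> c u a d" "mirrored (ell \<beta> + 1) a a'" "mirrored (ell \<beta>) d d'"
  shows "absorbed_right (rev \<beta>) (mirror (ell \<beta> + 1) c) (mirror (ell \<beta>) u) a' d'"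
  unfolding absorbed_right_def ell_rev
proof (intro conjI ballI)
  show "a' (ell \<beta> + 1) = mirror (ell \<beta> + 1) c (ell \<beta> + 1)"
    using assms(1) mirroredD[OF assms(2), of "ell \<beta> + 1"]
    by (simp add: absorbed_left_def mirror_def)
next
  fix i assume i: "i \<in> {1..ell \<beta>}"
  then have "ell \<beta> + 1 - i \<in> {1..ell \<beta>}" "ell \<beta> + 1 + 1 - i = ell \<beta> + 1 - i + 1" by auto
  moreover have "a' i = a (ell \<beta> + 1 + 1 - i)" "d' i = d (ell \<beta> + 1 - i)"
    using mirroredD[OF assms(2), of i] mirroredD[OF assms(3) i] i by auto
  ultimately show "(a' i, d' i) = absorb (mirror (ell \<beta> + 1) c i, mirror (ell \<beta>) u i)"
    using assms(1) unfolding absorbed_left_def mirror_def by metis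
qed

lemma Phi_graph_mirror:
  assumes "Phi_graph \<beta> a d b e" "mirrored (ell \<beta> + 1) a a'" "mirrored (ell \<beta>) d d'"
    "mirrored (ell \<beta> + 1) b b'" "mirrored (ell \<beta>) e e'"
  shows "Phi_graph (rev \<beta>) b' e' a' d'"
proof -
  obtain c t u v where c_le: "\<forall>j\<in>{1..ell \<beta> + 1}. c j \<le> cap \<beta> j"
    and graph: "phi_graph (ell \<beta>) (cut_at \<beta> c) t u v"
    and left: "absorbed_left \<beta> c u a d" and right: "absorbed_right \<beta> c v b e"
    using assms(1) unfolding Phi_graph_def by blast
  have "\<forall>j\<in>{1..ell \<beta> + 1}. mirror (ell \<beta> + 1) c j \<le> cap (rev \<beta>) j"
  proof
    fix j assume j: "j \<in> {1..ell \<beta> + 1}"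
    then have "ell \<beta> + 2 - j \<in> {1..ell \<beta> + 1}" by auto
    then show "mirror (ell \<beta> + 1) c j \<le> cap (rev \<beta>) j"
      using c_le cap_rev[OF j] by (simp add: mirror_def)
  qed
  moreover note phi_graph_mirror[OF graph mirrored_cut_at]
    absorbed_left_mirror[OF right assms(4,5)] absorbed_right_mirror[OF left assms(2,3)]
  ultimately show ?thesis unfolding Phi_graph_def ell_rev by blast
qed

lemma ideal_code_mirror:
  assumes "filter_code \<beta> b e" "mirrored (ell \<beta> + 1) b b'" "mirrored (ell \<beta>) e e'"
  shows "ideal_code (rev \<beta>) b' e'"
proof -
  have "b' j \<le> cap (rev \<beta>) j" if j: "j \<in> {1..ell \<beta> + 1}" for j
  proof -
    have "ell \<beta> + 2 - j \<in> {1..ell \<beta> + 1}" using j by auto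
    then show ?thesis
      using assms(1) mirroredD[OF assms(2) j] cap_rev[OF j] by (simp add: filter_code_def)
  qed
  moreover have "e' i \<le> delta (rev \<beta>) i + 1 \<and> (0 < b' (i + 1) \<longrightarrow> 0 < e' i) \<and>
      (e' i = delta (rev \<beta>) i + 1 \<longrightarrow> b' i = cap (rev \<beta>) i \<and> (1 < i \<longrightarrow> 0 < e' (i - 1)))"
    if i: "i \<in> {1..ell \<beta>}" for i
  proof -
    define k where "k = ell \<beta> + 1 - i"
    have k: "k \<in> {1..ell \<beta>}" "1 < i \<longleftrightarrow> k < ell \<beta>"
      and index_eqs: "ell \<beta> + 1 + 1 - (i + 1) = k" "ell \<beta> + 1 + 1 - i = k + 1"
        "ell \<beta> + 2 - i = k + 1" "ell \<beta> + 1 - i = k" "1 < i \<Longrightarrow> ell \<beta> + 1 - (i - 1) = k + 1"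
      using i by (auto simp: k_def)
    have "b' (i + 1) = b k" "b' i = b (k + 1)" "cap (rev \<beta>) i = cap \<beta> (k + 1)"
      "e' i = e k" "delta (rev \<beta>) i = delta \<beta> k"
      using i mirroredD[OF assms(2), of "i + 1"] mirroredD[OF assms(2), of i]
        mirroredD[OF assms(3) i] cap_rev[of i] delta_rev[OF i]
      unfolding index_eqs(1-4) by simp_all
    moreover have "e' (i - 1) = e (k + 1)" if "1 < i"
      using mirroredD[OF assms(3), of "i - 1"] index_eqs(5)[OF that] i that by fastforce
    ultimately show ?thesis
      using assms(1) k unfolding filter_code_def by simp
  qed
  ultimately show ?thesis unfolding ideal_code_def ell_rev by blast
qed

lemma restricted_ideal_code_mirror:
  assumes "restricted_filter_code \<beta> b e" "mirrored (ell \<beta> + 1) b b'" "mirrored (ell \<beta>) e e'"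
  shows "restricted_ideal_code (rev \<beta>) b' e'"
proof -
  have "e' 1 = e (ell \<beta>)" "delta (rev \<beta>) 1 = delta \<beta> (ell \<beta>)" "e' (ell \<beta>) = e 1"
    if "1 \<le> ell \<beta>"
    using mirroredD[OF assms(3), of 1] mirroredD[OF assms(3), of "ell \<beta>"] delta_rev[of 1] that
    by simp_all
  moreover have "b' (ell \<beta> + 1) = b 1" "cap (rev \<beta>) (ell \<beta> + 1) = cap \<beta> 1"
    using mirroredD[OF assms(2), of "ell \<beta> + 1"] cap_rev[of "ell \<beta> + 1"] by simp_all
  moreover have "ideal_code (rev \<beta>) b' e'"
    using assms(1) ideal_code_mirror[OF _ assms(2,3)] unfolding restricted_filter_code_def by blast
  ultimately show ?thesis
    using assms(1) unfolding restricted_ideal_code_def restricted_filter_code_def ell_rev by simp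
qed

lemma PH1_values:
  assumes "PH1 \<beta> (a, d) = (c, u)"
  shows "c 1 = a 1"
    and "i \<in> {1..ell \<beta>} \<Longrightarrow> (c (i + 1), u i) =
      (if d i = 1 \<and> a (i + 1) < cap \<beta> (i + 1) then (a (i + 1) + 1, 0) else (a (i + 1), d i))"
  using assms unfolding PH1_def alpha_minus_one Let_def by auto

lemma absorbed_right_PH3:
  assumes "PH3 \<beta> (c, v) = (b, e)"
  shows "absorbed_right \<beta> c v b e"
  using assms by (auto simp: absorbed_right_def absorb_def PH3_def Let_def)

lemma absorbed_left_PH1:
  assumes "ideal_code \<beta> a d" "PH1 \<beta> (a, d) = (c, u)"
  shows "absorbed_left \<beta> c u a d"
proof -
  have "(a (i + 1), d i) = absorb (c (i + 1), u i)" if "i \<in> {1..ell \<beta>}" for i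
  proof -
    have "0 < a (i + 1) \<longrightarrow> 0 < d i" using assms(1) that unfolding ideal_code_def by blast
    then show ?thesis
      using PH1_values(2)[OF assms(2) that] by (auto simp: absorb_def split: if_splits)
  qed
  then show ?thesis
    using PH1_values(1)[OF assms(2)] by (simp add: absorbed_left_def)
qed

lemma PH1_le_cap:
  assumes "ideal_code \<beta> a d" "PH1 \<beta> (a, d) = (c, u)" and j: "j \<in> {1..ell \<beta> + 1}"
  shows "c j \<le> cap \<beta> j"
proof -
  have a_le: "a j \<le> cap \<beta> j" using assms(1) j unfolding ideal_code_def by blast
  show ?thesis
  proof (cases "j = 1")
    case True
    then show ?thesis using PH1_values(1)[OF assms(2)] a_le by simp
  next
    case False
    then have "j - 1 \<in> {1..ell \<beta>}" "j - 1 + 1 = j" using j by auto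
    then show ?thesis using PH1_values(2)[OF assms(2), of "j - 1"] a_le by (auto split: if_splits)
  qed
qed

lemma reduced_ideal_code_PH1:
  assumes restricted: "restricted_ideal_code \<beta> a d" and steps: "PH1 \<beta> (a, d) = (c, u)"
  shows "reduced_ideal_code \<beta> c u"
proof -
  have code: "ideal_code \<beta> a d" and d_first: "1 \<le> ell \<beta> \<Longrightarrow> d 1 \<le> delta \<beta> 1"
    and d_last: "1 \<le> ell \<beta> \<Longrightarrow> d (ell \<beta>) = 1 \<Longrightarrow> a (ell \<beta> + 1) < cap \<beta> (ell \<beta> + 1)"
    using restricted unfolding restricted_ideal_code_def by blast+
  have d_le: "d i \<le> delta \<beta> i + 1"
    and d_full: "d i = delta \<beta> i + 1 \<Longrightarrow> a i = cap \<beta> i \<and> (1 < i \<longrightarrow> 0 < d (i - 1))"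
    if "i \<in> {1..ell \<beta>}" for i
    using code that unfolding ideal_code_def by blast+
  note PH1 = PH1_values(2)[OF steps] and c_le = PH1_le_cap[OF code steps]
  have "u i \<le> delta \<beta> i + 1" if "i \<in> {1..ell \<beta>}" for i
    using PH1[OF that] d_le[OF that] by (auto split: if_splits)
  moreover have "\<not> cut_at \<beta> c (i + 1)" if i: "i \<in> {1..ell \<beta>}" "u i = 1" for i
  proof -
    have "d i = 1" "\<not> a (i + 1) < cap \<beta> (i + 1)" "c (i + 1) = a (i + 1)"
      using PH1[OF i(1)] i(2) by (auto split: if_splits)
    then show ?thesis using d_last i(1) by (auto simp: cut_at_def)
  qed
  moreover have "\<not> cut_at \<beta> c i \<and> 0 < u (i - 1)" if i: "i \<in> {1..ell \<beta>}" "u i = delta \<beta> i + 1" for i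
  proof -
    have "d i = delta \<beta> i + 1" using PH1[OF i(1)] i(2) by (auto split: if_splits)
    then have d_prev: "i \<noteq> 1" "a i = cap \<beta> i" "1 < i \<longrightarrow> 0 < d (i - 1)"
      using d_first d_full[OF i(1)] i(1) by auto
    then have "i - 1 \<in> {1..ell \<beta>}" "i - 1 + 1 = i" using i(1) by auto
    then show ?thesis
      using PH1[of "i - 1"] d_prev i(1) by (auto simp: cut_at_def split: if_splits)
  qed
  ultimately show ?thesis unfolding reduced_ideal_code_def using c_le by blast
qed

lemma phi_graph_PH2:
  assumes "reduced_ideal_code \<beta> c u"
  obtains t v where "PH2 \<beta> (c, u) = (c, v)" "phi_graph (ell \<beta>) (cut_at \<beta> c) t u v"
proof -
  let ?us = "map u [1..<ell \<beta> + 1]"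
  have "factors (\<lambda>i. c i < alpha \<beta> i - 1) 1 ?us = factors (cut_at \<beta> c) 1 ?us"
    unfolding alpha_minus_one by (rule factors_cong) (auto simp: cut_at_def)
  moreover have "no_one_before_cut (cut_at \<beta> c) u 1 (ell \<beta> + 1)"
    using assms by (simp add: no_one_before_cut_def reduced_ideal_code_def cut_at_def)
  ultimately show thesis
    using phi_graph_concat_phi_factors[of "cut_at \<beta> c" u "ell \<beta>"]
    by (intro that) (simp_all add: PH2_def cut_at_def Let_def)
qed

lemma reduced_filter_code_phi_graph:
  assumes u: "reduced_ideal_code \<beta> c u" and graph: "phi_graph (ell \<beta>) (cut_at \<beta> c) t u v"
  shows "reduced_filter_code \<beta> c v"
proof -
  have at_block: "v i + of_bool (cut_at \<beta> c (i + 1) \<or> t (i + 1)) \<le> delta \<beta> i + 1"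
    if i: "i \<in> {1..ell \<beta>}" "\<not> t i" for i
  proof -
    have u_le: "u i \<le> delta \<beta> i + 1"
      and u_full: "u i = delta \<beta> i + 1 \<Longrightarrow> \<not> cut_at \<beta> c i \<and> 0 < u (i - 1)"
      using u i(1) unfolding reduced_ideal_code_def by blast+
    have "u i \<noteq> delta \<beta> i + 1" if first: "cut_at \<beta> c i \<or> t (i - 1)"
    proof
      assume "u i = delta \<beta> i + 1"
      then have prev: "\<not> cut_at \<beta> c i" "0 < u (i - 1)" "t (i - 1)" using u_full first by blast+
      then have "i - 1 \<in> {1..ell \<beta>}" "i - 1 + 1 = i"
        using phi_graph_cut_first[OF graph] i(1) by (cases "i = 1"; auto)+
      then show False using phi_graph_run_iff_dom[OF graph, of "i - 1"] prev i(2) by simp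
    qed
    then have "u i + of_bool (cut_at \<beta> c i \<or> t (i - 1)) \<le> delta \<beta> i + 1"
      using u_le by (cases "cut_at \<beta> c i \<or> t (i - 1)") auto
    then show ?thesis using phi_graph_not_at_run[OF graph i] by simp
  qed
  have "v i \<le> delta \<beta> i + 1" if "i \<in> {1..ell \<beta>}" for i
    using phi_graph_img_at_run[OF graph that] at_block[OF that] by (cases "t i") auto
  moreover have "\<not> cut_at \<beta> c (i + 1) \<and> 0 < v (i + 1)"
    if i: "i \<in> {1..ell \<beta>}" "v i = delta \<beta> i + 1" for i
  proof -
    have "\<not> t i"
      using phi_graph_img_at_run[OF graph i(1)] i(2) delta_pos[OF i(1)]
      by (auto simp: of_bool_def split: if_splits)
    then have not: "\<not> cut_at \<beta> c (i + 1)" "\<not> t (i + 1)" using at_block[OF i(1)] i(2) by auto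
    then have "i + 1 \<in> {1..ell \<beta>}"
      using phi_graph_cut_last[OF graph] i(1) by (cases "i = ell \<beta>") auto
    then show ?thesis using phi_graph_run_iff_img[OF graph, of "i + 1"] not by auto
  qed
  ultimately show ?thesis
    using u phi_graph_one_after_cut[OF graph]
    unfolding reduced_ideal_code_def reduced_filter_code_def by blast
qed

lemma absorbed_right_values:
  assumes "absorbed_right \<beta> c v b e" "i \<in> {1..ell \<beta>}"
  shows "(b i, e i) = (if v i = 0 \<and> 0 < c i then (c i - 1, 1) else (c i, v i))"
  using assms by (simp add: absorbed_right_def absorb_def)

lemma absorbed_right_full:
  assumes v: "reduced_filter_code \<beta> c v" and right: "absorbed_right \<beta> c v b e"
    and i: "i \<in> {1..ell \<beta>}" "e i = delta \<beta> i + 1"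
  shows "i < ell \<beta>" "b (i + 1) = cap \<beta> (i + 1)" "0 < e (i + 1)"
proof -
  have "v i = delta \<beta> i + 1"
    using absorbed_right_values[OF right i(1)] i(2) delta_pos[OF i(1)] by (auto split: if_splits)
  then have next_v: "\<not> cut_at \<beta> c (i + 1)" "0 < v (i + 1)" "c (i + 1) \<le> cap \<beta> (i + 1)"
    using v i(1) unfolding reduced_filter_code_def by auto
  then show "i < ell \<beta>" using i(1) by (auto simp: cut_at_def)
  then show "b (i + 1) = cap \<beta> (i + 1)" "0 < e (i + 1)"
    using absorbed_right_values[OF right, of "i + 1"] next_v i(1) by (auto simp: cut_at_def)
qed

lemma filter_code_absorbed_right:
  assumes v: "reduced_filter_code \<beta> c v" and right: "absorbed_right \<beta> c v b e"
  shows "filter_code \<beta> b e"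
proof -
  have c_le: "c j \<le> cap \<beta> j" if "j \<in> {1..ell \<beta> + 1}" for j
    using v that unfolding reduced_filter_code_def by blast
  have v_le: "v i \<le> delta \<beta> i + 1" if "i \<in> {1..ell \<beta>}" for i
    using v that unfolding reduced_filter_code_def by blast
  have "b j \<le> cap \<beta> j" if j: "j \<in> {1..ell \<beta> + 1}" for j
  proof (cases "j = ell \<beta> + 1")
    case True
    then show ?thesis using right c_le[OF j] by (simp add: absorbed_right_def)
  next
    case False
    then show ?thesis
      using absorbed_right_values[OF right, of j] c_le[OF j] j by (auto split: if_splits)
  qed
  moreover have "e i \<le> delta \<beta> i + 1 \<and> (0 < b i \<longrightarrow> 0 < e i)" if "i \<in> {1..ell \<beta>}" for i
    using absorbed_right_values[OF right that] v_le[OF that] by (auto split: if_splits)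
  ultimately show ?thesis
    unfolding filter_code_def using absorbed_right_full[OF v right] by blast
qed

lemma restricted_filter_code_absorbed_right:
  assumes v: "reduced_filter_code \<beta> c v" and right: "absorbed_right \<beta> c v b e"
  shows "restricted_filter_code \<beta> b e"
proof -
  have code: "filter_code \<beta> b e" by (rule filter_code_absorbed_right[OF v right])
  have "e (ell \<beta>) \<le> delta \<beta> (ell \<beta>)" if "1 \<le> ell \<beta>"
  proof -
    have "e (ell \<beta>) \<le> delta \<beta> (ell \<beta>) + 1" using code that by (simp add: filter_code_def)
    moreover have "e (ell \<beta>) \<noteq> delta \<beta> (ell \<beta>) + 1"
      using absorbed_right_full(1)[OF v right, of "ell \<beta>"] that by auto
    ultimately show ?thesis by linarith
  qed
  moreover have "b 1 < cap \<beta> 1" if "1 \<le> ell \<beta>" "e 1 = 1"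
  proof -
    have "v 1 \<noteq> 1" "c 1 \<le> cap \<beta> 1"
      using v that(1) by (auto simp: reduced_filter_code_def cut_at_def)
    then show ?thesis
      using absorbed_right_values[OF right, of 1] that by (auto split: if_splits)
  qed
  ultimately show ?thesis unfolding restricted_filter_code_def using code by blast
qed

lemma Phi_graph_steps:
  assumes "restricted_ideal_code \<beta> a d" "PH3 \<beta> (PH2 \<beta> (PH1 \<beta> (a, d))) = (b, e)"
  shows "Phi_graph \<beta> a d b e" "restricted_filter_code \<beta> b e"
proof -
  obtain c u where PH1: "PH1 \<beta> (a, d) = (c, u)" by (cases "PH1 \<beta> (a, d)")
  have u: "reduced_ideal_code \<beta> c u"
    by (rule reduced_ideal_code_PH1[OF assms(1) PH1])
  obtain t v where PH2: "PH2 \<beta> (c, u) = (c, v)" and graph: "phi_graph (ell \<beta>) (cut_at \<beta> c) t u v"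
    using phi_graph_PH2[OF u] by blast
  have v: "reduced_filter_code \<beta> c v"
    by (rule reduced_filter_code_phi_graph[OF u graph])
  have right: "absorbed_right \<beta> c v b e"
    using assms(2) unfolding PH1 PH2 by (rule absorbed_right_PH3)
  have "absorbed_left \<beta> c u a d"
    using assms(1) PH1 absorbed_left_PH1 unfolding restricted_ideal_code_def by blast
  moreover have "\<forall>j\<in>{1..ell \<beta> + 1}. c j \<le> cap \<beta> j"
    using u unfolding reduced_ideal_code_def by blast
  ultimately show "Phi_graph \<beta> a d b e"
    unfolding Phi_graph_def using graph right by blast
  show "restricted_filter_code \<beta> b e"
    by (rule restricted_filter_code_absorbed_right[OF v right])
qed

end

section \<open>Bijectivity\<close>

context odd_composition
begin

lemma Phi_graph_inj:
  assumes "Phi_graph \<beta> a d b e" "Phi_graph \<beta> a' d' b e"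
  shows "j \<in> {1..ell \<beta> + 1} \<Longrightarrow> a j = a' j" and "i \<in> {1..ell \<beta>} \<Longrightarrow> d i = d' i"
proof -
  note mirror = Phi_graph_mirror[OF _ mirrored_mirror mirrored_mirror mirrored_mirror
      mirrored_mirror]
  note functional =
    Phi_graph_functional[OF mirror[OF assms(1)] mirror[OF assms(2)], unfolded ell_rev]
  show "a j = a' j" if j: "j \<in> {1..ell \<beta> + 1}"
  proof -
    have "ell \<beta> + 2 - j \<in> {1..ell \<beta> + 1}" using j by auto
    then show ?thesis using functional(1)[of "ell \<beta> + 2 - j"] j by (simp add: mirror_def)
  qed
  show "d i = d' i" if i: "i \<in> {1..ell \<beta>}"
  proof -
    have "ell \<beta> + 1 - i \<in> {1..ell \<beta>}" using i by auto
    then show ?thesis using functional(2)[of "ell \<beta> + 1 - i"] i by (simp add: mirror_def)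
  qed
qed

lemma Phi_graph_surj:
  assumes "restricted_filter_code \<beta> b e"
  obtains a d where "restricted_ideal_code \<beta> a d" "Phi_graph \<beta> a d b e"
proof -
  interpret rev: odd_composition "rev \<beta>" by (rule odd_composition_rev)
  define b' e' where "b' = mirror (ell \<beta> + 1) b" and "e' = mirror (ell \<beta>) e"
  have b': "mirrored (ell \<beta> + 1) b b'" and e': "mirrored (ell \<beta>) e e'"
    unfolding b'_def e'_def by (rule mirrored_mirror)+
  obtain x y where steps: "PH3 (rev \<beta>) (PH2 (rev \<beta>) (PH1 (rev \<beta>) (b', e'))) = (x, y)"
    by fastforce
  note xy = rev.Phi_graph_steps[OF restricted_ideal_code_mirror[OF assms b' e'] steps]
  show thesis
  proof
    show "restricted_ideal_code \<beta> (mirror (ell \<beta> + 1) x) (mirror (ell \<beta>) y)"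
      using rev.restricted_ideal_code_mirror[OF xy(2)] by (simp add: ell_rev mirrored_mirror)
    show "Phi_graph \<beta> (mirror (ell \<beta> + 1) x) (mirror (ell \<beta>) y) b e"
      using rev.Phi_graph_mirror[OF xy(1)] b'[THEN mirrored_sym] e'[THEN mirrored_sym]
      by (simp add: ell_rev mirrored_mirror)
  qed
qed

lemma restricted_ideal_codeD:
  assumes "restricted_ideal \<beta> I"
  shows "restricted_ideal_code \<beta> (acode \<beta> I) (dcode \<beta> I)"
  using assms ideal_code_of_ideal
  unfolding restricted_ideal_def restricted_ideal_code_def alpha_minus_one by blast

lemma restricted_filter_codeD:
  assumes "restricted_filter \<beta> U"
  shows "restricted_filter_code \<beta> (acode \<beta> U) (dcode \<beta> U)"
  using assms filter_code_of_filter
  unfolding restricted_filter_def restricted_filter_code_def alpha_minus_one by blast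

lemma restricted_idealI:
  assumes "I \<in> fence_ideals \<beta>" "encodes \<beta> I (a, d)" "restricted_ideal_code \<beta> a d"
  shows "restricted_ideal \<beta> I"
  using assms unfolding restricted_ideal_def restricted_ideal_code_def alpha_minus_one
  by (simp add: encodes_def)

lemma restricted_filterI:
  assumes "U \<in> fence_filters \<beta>" "encodes \<beta> U (b, e)" "restricted_filter_code \<beta> b e"
  shows "restricted_filter \<beta> U"
  using assms unfolding restricted_filter_def restricted_filter_code_def alpha_minus_one
  by (simp add: encodes_def)

lemma Phi_restricted:
  assumes "restricted_ideal \<beta> I"
  shows "restricted_filter \<beta> (Phi \<beta> I)"
    and "Phi_graph \<beta> (acode \<beta> I) (dcode \<beta> I) (acode \<beta> (Phi \<beta> I)) (dcode \<beta> (Phi \<beta> I))"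
proof -
  obtain b e where steps: "PH3 \<beta> (PH2 \<beta> (PH1 \<beta> (acode \<beta> I, dcode \<beta> I))) = (b, e)"
    by fastforce
  note be = Phi_graph_steps[OF restricted_ideal_codeD[OF assms] steps]
  define U where "U = filter_set \<beta> b e"
  have "filter_code \<beta> b e" using be(2) by (simp add: restricted_filter_code_def)
  then have U: "U \<in> fence_filters \<beta>" "encodes \<beta> U (b, e)"
    unfolding U_def by (rule filter_set_in_fence_filters, rule encodes_filter_set)
  have "Phi \<beta> I = U"
    unfolding Phi_def steps
  proof (rule the_equality)
    fix V assume "V \<in> fence_filters \<beta> \<and> encodes \<beta> V (b, e)"
    then show "V = U" using U by (intro filter_eqI) (auto simp: encodes_def)
  qed (use U in blast)
  then show "restricted_filter \<beta> (Phi \<beta> I)"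
    and "Phi_graph \<beta> (acode \<beta> I) (dcode \<beta> I) (acode \<beta> (Phi \<beta> I)) (dcode \<beta> (Phi \<beta> I))"
    using restricted_filterI[OF U be(2)] Phi_graph_encodes[OF be(1) encodes_codes U(2)] by simp_all
qed

lemma card_Phi:
  assumes "restricted_ideal \<beta> I"
  shows "card (Phi \<beta> I) = card I"
proof -
  have "I \<subseteq> fence \<beta>" using assms by (simp add: restricted_ideal_def fence_ideals_def)
  moreover have "Phi \<beta> I \<subseteq> fence \<beta>"
    using Phi_restricted(1)[OF assms] by (simp add: restricted_filter_def fence_filters_def)
  ultimately show ?thesis
    using sum_Phi_graph[OF Phi_restricted(2)[OF assms]] by (simp only: card_eq_sum_codes)
qed

lemma Phi_inj:
  assumes I: "restricted_ideal \<beta> I" and J: "restricted_ideal \<beta> J" and eq: "Phi \<beta> I = Phi \<beta> J"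
  shows "I = J"
proof -
  have "encodes \<beta> I (acode \<beta> J, dcode \<beta> J)"
    using Phi_graph_inj[OF Phi_restricted(2)[OF I] Phi_restricted(2)[OF J, folded eq]]
    by (simp add: encodes_def)
  then show ?thesis
    using I J ideal_eqI by (simp add: restricted_ideal_def)
qed

lemma Phi_surj:
  assumes "restricted_filter \<beta> U"
  obtains I where "restricted_ideal \<beta> I" "Phi \<beta> I = U"
proof -
  obtain a d where ad: "restricted_ideal_code \<beta> a d" "Phi_graph \<beta> a d (acode \<beta> U) (dcode \<beta> U)"
    using Phi_graph_surj[OF restricted_filter_codeD[OF assms]] by blast
  obtain I where I: "I \<in> fence_ideals \<beta>" "encodes \<beta> I (a, d)"
    using ad(1) ex_ideal_encodes unfolding restricted_ideal_code_def by blast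
  have restricted: "restricted_ideal \<beta> I" by (rule restricted_idealI[OF I ad(1)])
  have graph: "Phi_graph \<beta> (acode \<beta> I) (dcode \<beta> I) (acode \<beta> U) (dcode \<beta> U)"
    by (rule Phi_graph_encodes[OF ad(2) I(2) encodes_codes])
  have "Phi \<beta> I = U"
    using Phi_graph_functional[OF Phi_restricted(2)[OF restricted] graph]
      Phi_restricted(1)[OF restricted] assms
    by (intro filter_eqI) (simp_all add: restricted_filter_def encodes_def)
  with restricted show thesis by (rule that)
qed

end

theorem theorem4p1:
  fixes \<beta> :: "nat list" and k :: nat
  assumes "\<forall>x\<in>set \<beta>. 0 < x" and "odd (length \<beta>)"
  shows "bij_betw (Phi \<beta>) (restricted_ideals \<beta> k) (restricted_filters \<beta> k)"
proof -
  interpret odd_composition \<beta> using assms by unfold_locales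
  show ?thesis
  proof (rule bij_betwI')
    fix I J assume "I \<in> restricted_ideals \<beta> k" "J \<in> restricted_ideals \<beta> k"
    then show "Phi \<beta> I = Phi \<beta> J \<longleftrightarrow> I = J"
      using Phi_inj by (auto simp: restricted_ideals_def)
  next
    fix I assume "I \<in> restricted_ideals \<beta> k"
    then show "Phi \<beta> I \<in> restricted_filters \<beta> k"
      using Phi_restricted(1) card_Phi by (simp add: restricted_ideals_def restricted_filters_def)
  next
    fix U assume U: "U \<in> restricted_filters \<beta> k"
    then obtain I where "restricted_ideal \<beta> I" "Phi \<beta> I = U"
      using Phi_surj by (auto simp: restricted_filters_def)
    then show "\<exists>I\<in>restricted_ideals \<beta> k. U = Phi \<beta> I"
      using U card_Phi[of I] by (auto simp: restricted_ideals_def restricted_filters_def)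
  qed
qed

end
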